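(* Suppose $p, q, r, n \in \mathbb{N}$ with $p, q, r \ge 2$ and $\gcd(p,q) = 1$. Further suppose that $k$ and $e$ are the integers with $k \ge 0$, $1 \le e < q$, and $p = kq + e$. The twisted torus knot $K(p,q,r,-n)$ is positive if $n < k+1$, or if $n = k+1$ and $r \le e$.
   Context: For coprime $p,q$, the torus knot $T(p,q)$ lies on an unknotted torus in $S^3$, wrapping $p$ times around the meridian and $q$ times around the longitude; it is taken with the handedness for which it has a diagram with all crossings positive, namely the closure of the $q$-strand braid $(\sigma_{q-1}\sigma_{q-2}\cdots\sigma_1)^p$, where $\sigma_i$ is the standard braid generator giving a positive crossing between strands $i$ and $i+1$. For an integer $n$, the twisted torus knot $K(p,q,r,n)$ is the knot obtained from $T(p,q)$ by adding $n$ full twists to $r$ adjacent strands, the direction of twisting being determined by the sign of $n$ (negative $n$ means negative full twists). It has a natural position on the genus two Heegaard surface of $S^3$: let $D$ be a small disk in the unknotted torus $T$ containing $T(p,q)$ that meets $T(p,q)$ in $r$ adjacent sub-arcs; let $T'$ be another unknotted torus containing $r$ parallel copies of $T(1,n)$, and let $D'$ be a small disk in $T'$ meeting this link in $r$ adjacent sub-arcs; remove $D$ from $T$ and $D'$ from $T'$ and identify the resulting boundaries, keeping orientations consistent. In terms of braids, with the $n$ full twists put into the first $r$ strands of the $q$-strand braid above, $K(p,q,r,n)$ is represented as the closure of $(\sigma_{q-1}\cdots\sigma_1)^p(\sigma_{r-1}\cdots\sigma_1)^{rn}$. A knot is positive if it has a diagram all of whose crossings are positive. *)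

theory Defs
  imports "HOL-Analysis.Analysis"
begin

section \<open>Knots up to ambient isotopy\<close>

text \<open>
  Knots are subsets of \<open>\<real>\<^sup>3\<close>, considered up to ambient isotopy. Working in \<open>\<real>\<^sup>3\<close> instead of \<open>S\<^sup>3\<close>
  does not change the isotopy classes. No orientation is recorded: reversing a knot
  reverses both strands at every crossing and therefore preserves all crossing signs.
\<close>

definition ambient_isotopic :: "'a::topological_space set \<Rightarrow> 'a set \<Rightarrow> bool" where
  "ambient_isotopic K L \<longleftrightarrow>
     (\<exists>H :: real \<times> 'a \<Rightarrow> 'a.
        continuous_on ({0..1} \<times> UNIV) H \<and>
        (\<forall>t\<in>{0..1}. \<exists>g. homeomorphism UNIV UNIV (\<lambda>x. H (t, x)) g) \<and>
        (\<forall>x. H (0, x) = x) \<and>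
        (\<lambda>x. H (1, x)) ` K = L)"

section \<open>Polygonal knot diagrams\<close>

text \<open>
  A diagram is given by a cyclic list of vertices in \<open>\<real>\<^sup>3\<close>, traversed in list order, and is
  projected along the third coordinate axis; the third coordinate decides which strand is over.
\<close>

definition next_vertex :: "'a list \<Rightarrow> nat \<Rightarrow> 'a" where
  "next_vertex vs i = vs ! (Suc i mod length vs)"

definition edge :: "(real^3) list \<Rightarrow> nat \<Rightarrow> (real^3) set" where
  "edge vs i = closed_segment (vs ! i) (next_vertex vs i)"

definition closed_polygon :: "(real^3) list \<Rightarrow> (real^3) set" where
  "closed_polygon vs = (\<Union>i<length vs. edge vs i)"

definition plane_proj :: "real^3 \<Rightarrow> real^2" where
  "plane_proj v = vector [v $ 1, v $ 2]"

text \<open>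
  The third condition below makes the projected vertices distinct and forces any two
  projected edges that are not consecutive to be disjoint or to cross transversally at one
  interior point of each; the fourth excludes triple points. The last one says that the polygon
  itself is embedded: edges of the polygon meet only in vertices, which by the third condition
  are then common end points of the two edges.
\<close>

definition knot_diagram :: "(real^3) list \<Rightarrow> bool" where
  "knot_diagram vs \<longleftrightarrow>
     length vs \<ge> 3 \<and>
     distinct vs \<and>
     (\<forall>i<length vs. \<forall>j<length vs.
        plane_proj (vs ! i) \<in> plane_proj ` edge vs j \<longrightarrow> i = j \<or> i = Suc j mod length vs) \<and>
     (\<forall>i<length vs. \<forall>j<length vs. \<forall>k<length vs. i \<noteq> j \<and> j \<noteq> k \<and> i \<noteq> k \<longrightarrow>
        plane_proj ` edge vs i \<inter> plane_proj ` edge vs j \<inter> plane_proj ` edge vs k = {}) \<and>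
     (\<forall>i<length vs. \<forall>j<length vs. i \<noteq> j \<longrightarrow> edge vs i \<inter> edge vs j \<subseteq> set vs)"

text \<open>Edge \<open>i\<close> crosses over edge \<open>j\<close>.\<close>

definition crosses_over :: "(real^3) list \<Rightarrow> nat \<Rightarrow> nat \<Rightarrow> bool" where
  "crosses_over vs i j \<longleftrightarrow>
     i < length vs \<and> j < length vs \<and>
     (\<exists>a\<in>edge vs i. \<exists>b\<in>edge vs j. plane_proj a = plane_proj b \<and> a $ 3 > b $ 3)"

text \<open>
  Right-hand rule: a crossing is positive if the direction of the over-strand is turned
  counterclockwise, through an angle less than \<open>\<pi>\<close>, onto the direction of the under-strand.
\<close>

definition crossing_sign :: "(real^3) list \<Rightarrow> nat \<Rightarrow> nat \<Rightarrow> real" where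
  "crossing_sign vs i j =
     (let u = next_vertex vs i - vs ! i; v = next_vertex vs j - vs ! j
      in sgn (u $ 1 * v $ 2 - u $ 2 * v $ 1))"

definition diagram_of :: "(real^3) list \<Rightarrow> (real^3) set \<Rightarrow> bool" where
  "diagram_of vs K \<longleftrightarrow> knot_diagram vs \<and> ambient_isotopic K (closed_polygon vs)"

definition positive_knot :: "(real^3) set \<Rightarrow> bool" where
  "positive_knot K \<longleftrightarrow>
     (\<exists>vs. diagram_of vs K \<and> (\<forall>i j. crosses_over vs i j \<longrightarrow> crossing_sign vs i j = 1))"

section \<open>Braid words and their closures\<close>

text \<open>
  A braid word on \<open>q\<close> strands is a list of nonzero integers of absolute value less than \<open>q\<close>;
  \<open>i\<close> stands for \<open>\<sigma>\<^sub>i\<close> and \<open>- i\<close> for its inverse.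
\<close>

type_synonym braid_word = "int list"

definition braid_inverse :: "braid_word \<Rightarrow> braid_word" where
  "braid_inverse w = map uminus (rev w)"

definition braid_power :: "braid_word \<Rightarrow> int \<Rightarrow> braid_word" where
  "braid_power w n =
     (if n \<ge> 0 then concat (replicate (nat n) w)
      else concat (replicate (nat (- n)) (braid_inverse w)))"

abbreviation point3 :: "real \<Rightarrow> real \<Rightarrow> real \<Rightarrow> real^3" where
  "point3 x y z \<equiv> vector [x, y, z]"

fun polyline :: "'a::real_vector list \<Rightarrow> 'a set" where
  "polyline [] = {}"
| "polyline [a] = {a}"
| "polyline (a # b # xs) = closed_segment a b \<union> polyline (b # xs)"

text \<open>
  The strands run upwards in the half-plane \<open>x > 0\<close>, strand position \<open>x\<close> at height \<open>y\<close> being the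
  point \<open>(x, y, 0)\<close>.
  The letter at height \<open>y\<close> occupies the heights from \<open>y\<close> to \<open>y + 1\<close>.
  For \<open>\<sigma>\<^sub>i\<close> the strand from position \<open>i\<close> to position \<open>i + 1\<close> is over, which is a positive crossing
  for upward strands; for the inverse of \<open>\<sigma>\<^sub>i\<close> the strand from \<open>i + 1\<close> to \<open>i\<close> is over.
\<close>

definition letter_strands :: "nat \<Rightarrow> real \<Rightarrow> int \<Rightarrow> (real^3) set" where
  "letter_strands q y a =
     (let i = nat \<bar>a\<bar>;
          s = (if a > 0 then real i else real i + 1);
          t = (if a > 0 then real i + 1 else real i)
      in (\<Union>x\<in>{1..q} - {i, i + 1}. closed_segment (point3 x y 0) (point3 x (y + 1) 0)) \<union>
         polyline [point3 s y 0, point3 (real i + 1/2) (y + 1/2) 1, point3 t (y + 1) 0] \<union>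
         closed_segment (point3 t y 0) (point3 s (y + 1) 0))"

text \<open>
  The closing arcs join the top end to the bottom end of each strand position along nested
  rectangles in the plane \<open>z = 0\<close>, without crossings.
\<close>

definition closing_arc :: "real \<Rightarrow> real \<Rightarrow> (real^3) set" where
  "closing_arc h x =
     polyline [point3 x h 0, point3 x (h + x) 0, point3 (- x) (h + x) 0,
               point3 (- x) (- x) 0, point3 x (- x) 0, point3 x 0 0]"

definition braid_closure :: "nat \<Rightarrow> braid_word \<Rightarrow> (real^3) set" where
  "braid_closure q w =
     (\<Union>j<length w. letter_strands q (real j) (w ! j)) \<union>
     (\<Union>x\<in>{1..q}. closing_arc (real (length w)) (real x))"

section \<open>Twisted torus knots\<close>

text \<open>The word \<open>\<sigma>\<^sub>m\<^sub>-\<^sub>1 \<dots> \<sigma>\<^sub>1\<close>; its \<open>m\<close>-th power is the positive full twist on the first \<open>m\<close> strands.\<close>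

definition descending_word :: "nat \<Rightarrow> braid_word" where
  "descending_word m = map int (rev [1..<m])"

text \<open>
  \<open>K(p,q,r,n)\<close>, for \<open>r \<le> q\<close>: the standard \<open>q\<close>-strand closed braid of \<open>T(p,q)\<close> with \<open>n\<close> full twists
  put into its first \<open>r\<close> strands.
\<close>

definition twisted_torus_knot :: "nat \<Rightarrow> nat \<Rightarrow> nat \<Rightarrow> int \<Rightarrow> (real^3) set" where
  "twisted_torus_knot p q r n =
     braid_closure q
       (braid_power (descending_word q) (int p) @ braid_power (descending_word r) (int r * n))"

end

theory Submission
  imports Defs
begin

text \<open>
  The full twist on \<open>q\<close> strands is central in the braid group and is the full twist on the first \<open>r\<close>
  strands times a positive braid \<open>Y\<close> (\<open>full_twist_central\<close>, \<open>full_twist_splits_full_twist\<close>). Because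
  \<open>p = k q + e\<close>, the standard braid of \<open>T(p,q)\<close> consists of \<open>k\<close> full twists and the \<open>e\<close>-th power of
  \<open>\<sigma>\<^sub>q\<^sub>-\<^sub>1 \<dots> \<sigma>\<^sub>1\<close>. Each of the \<open>k\<close> full twists can absorb one negative full twist on \<open>r\<close> strands and
  leaves \<open>Y\<close>. In the remaining \<open>e\<close>-th power, the \<open>e\<close> strands that pass under the others make a full
  twist among themselves (\<open>descending_power_splits_full_twist\<close>), so for \<open>r \<le> e\<close> it absorbs one negative
  full twist more. Hence \<open>twisted_torus_word_positive\<close>: up to the braid relations, the given word is
  positive.

  To turn this into an ambient isotopy, a braid word is read as a motion of labelled points in a
  half-plane with complex coordinate \<open>x + \<i> z\<close>, the height \<open>y\<close> being the time; it is a path in a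
  configuration space. Two motions with the same ends are homotopic as soon as the strands can be
  stacked in the same order in both (\<open>homotopic_paths_layered\<close>): spread the strands to different depths,
  slide them there, and bring them back. Both sides of each braid relation are stacked in the same
  order, so words related by braid relations give homotopic paths (\<open>braid_eq_imp_homotopic\<close>). A homotopy
  of motions is in turn followed by an ambient isotopy (\<open>homotopic_motions_ambient_isotopic\<close>): it is cut
  into small steps, and in each step the horizontal planes are moved by a Lipschitz-small displacement
  that is supported near the strands.

  Finally, the closure of a positive word is drawn as a polygon. The two strands of a letter, as
  prescribed, project to segments one of which has a vertex on the other one; therefore the over-strand
  is first raised and only then moved across, which is again a homotopic motion. The resulting polygon is
  one closed curve because the underlying permutation is the rotation by \<open>p\<close> of \<open>q\<close> places and
  \<open>p\<close> and \<open>q\<close> are coprime (\<open>rotation_single_cycle\<close>), and its crossings are exactly those of the letters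
  (\<open>edges_meet_cases\<close>), all of them positive (\<open>positive_crossings\<close>).
\<close>

section \<open>Braid words up to the braid relations\<close>

text \<open>
  The letters are not bounded, so this is equality in the braid group on infinitely many strands; the
  number of strands matters only for closures. Commutation and braid relations that involve inverse
  letters follow from \<open>cancel\<close>.
\<close>

inductive braid_eq :: "braid_word \<Rightarrow> braid_word \<Rightarrow> bool" (infix "\<doteq>" 50) where
  reflexive [iff]: "w \<doteq> w"
| symmetric: "v \<doteq> w \<Longrightarrow> w \<doteq> v"
| transitive [trans]: "u \<doteq> v \<Longrightarrow> v \<doteq> w \<Longrightarrow> u \<doteq> w"
| Cons: "v \<doteq> w \<Longrightarrow> a # v \<doteq> a # w"
| append_right: "v \<doteq> w \<Longrightarrow> v @ u \<doteq> w @ u"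
| cancel: "a \<noteq> 0 \<Longrightarrow> [a, - a] \<doteq> []"
| far: "1 \<le> i \<Longrightarrow> i + 2 \<le> j \<Longrightarrow> [i, j] \<doteq> [j, i]"
| braid: "1 \<le> i \<Longrightarrow> [i, i + 1, i] \<doteq> [i + 1, i, i + 1]"

lemma braid_eq_append:
  assumes "u \<doteq> u'" "v \<doteq> v'" shows "u @ v \<doteq> u' @ v'"
proof -
  have "u @ v \<doteq> u @ v'"
    by (induction u) (auto intro: braid_eq.Cons assms)
  also have "\<dots> \<doteq> u' @ v'" by (intro braid_eq.append_right assms)
  finally show ?thesis .
qed

lemma braid_eq_append_left: "v \<doteq> v' \<Longrightarrow> u @ v \<doteq> u @ v'"
  by (simp add: braid_eq_append)

abbreviation word_power :: "braid_word \<Rightarrow> nat \<Rightarrow> braid_word" where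
  "word_power w n \<equiv> concat (replicate n w)"

lemma word_power_add: "word_power w (m + n) = word_power w m @ word_power w n"
  by (simp add: replicate_add)

lemma word_power_mult: "word_power (word_power w m) n = word_power w (m * n)"
  by (induction n) (simp_all add: word_power_add)

lemma braid_power_negative: "braid_power w (int m * - int n) = word_power (braid_inverse w) (m * n)"
proof (cases "m * n = 0")
  case False
  then have "int m * - int n < 0" by (simp add: mult_pos_neg)
  moreover have "nat (- (int m * - int n)) = m * n" by (simp add: nat_mult_distrib)
  ultimately show ?thesis by (simp add: braid_power_def)
qed (auto simp: braid_power_def)

lemma word_power_Suc_right: "word_power w (Suc n) = word_power w n @ w"
  using word_power_add[of n 1 w] by simp

lemma commute_power:
  assumes "v @ w \<doteq> w @ v" shows "v @ word_power w n \<doteq> word_power w n @ v"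
proof (induction n)
  case (Suc n)
  have "v @ word_power w (Suc n) \<doteq> (w @ v) @ word_power w n"
    using braid_eq.append_right[OF assms] by simp
  also have "\<dots> \<doteq> w @ word_power w n @ v"
    using braid_eq_append_left[OF Suc] by simp
  finally show ?case by simp
qed simp

lemma word_commute:
  assumes "\<And>a. a \<in> set v \<Longrightarrow> a # w \<doteq> w @ [a]" shows "v @ w \<doteq> w @ v"
  using assms
proof (induction v)
  case (Cons a v)
  have "(a # v) @ w \<doteq> a # w @ v"
    using Cons by (simp add: braid_eq.Cons)
  also have "\<dots> \<doteq> (w @ [a]) @ v"
    using braid_eq.append_right[OF Cons.prems, of a v] by simp
  finally show ?case by simp
qed simp

lemma far_commute:
  assumes "\<And>a. a \<in> set w \<Longrightarrow> 1 \<le> a \<and> a + 2 \<le> j" shows "j # w \<doteq> w @ [j]"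
  using assms
proof (induction w)
  case (Cons a w)
  have "j # a # w \<doteq> a # j # w"
    using braid_eq.append_right[OF braid_eq.far[of a j, THEN braid_eq.symmetric], of w] Cons.prems by simp
  also have "\<dots> \<doteq> a # w @ [j]"
    using Cons by (intro braid_eq.Cons) auto
  finally show ?case by simp
qed simp

lemma cancel_inverse:
  assumes "0 \<notin> set w" shows "w @ braid_inverse w \<doteq> []"
  using assms
proof (induction w)
  case (Cons a w)
  have "(a # w) @ braid_inverse (a # w) = a # (w @ braid_inverse w) @ [- a]"
    by (simp add: braid_inverse_def)
  also have "\<dots> \<doteq> a # [] @ [- a]"
    using Cons by (intro braid_eq.Cons braid_eq.append_right) auto
  also have "\<dots> \<doteq> []" using Cons.prems braid_eq.cancel[of a] by auto
  finally show ?case .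
qed (simp add: braid_inverse_def)

lemma cancel_inverse_power:
  assumes "0 \<notin> set w" shows "word_power w n @ word_power (braid_inverse w) n \<doteq> []"
proof (induction n)
  case (Suc n)
  have "word_power w (Suc n) @ word_power (braid_inverse w) (Suc n)
      = word_power w n @ (w @ braid_inverse w) @ word_power (braid_inverse w) n"
    unfolding word_power_Suc_right[of n w] by simp
  also have "\<dots> \<doteq> word_power w n @ [] @ word_power (braid_inverse w) n"
    by (intro braid_eq_append braid_eq.reflexive cancel_inverse assms)
  also have "\<dots> \<doteq> []" using Suc by simp
  finally show ?case .
qed simp

section \<open>Powers of the descending word\<close>

lemma descending_word_Suc: "1 \<le> m \<Longrightarrow> descending_word (Suc m) = int m # descending_word m"
  by (simp add: descending_word_def)

lemma set_descending_word: "set (descending_word m) = int ` {1..<m}"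
  by (simp add: descending_word_def)

text \<open>
  The descending word takes the strand in place \<open>m\<close> under all others to the first place and shifts the
  others by one place: a crossing of places \<open>i\<close> and \<open>i + 1\<close> before it becomes one of \<open>i + 1\<close> and \<open>i + 2\<close>
  after it.
\<close>

lemma descending_shift:
  assumes "1 \<le> i" "i + 2 \<le> m"
  shows "int i # descending_word m \<doteq> descending_word m @ [int (Suc i)]"
  using assms
proof (induction m)
  case (Suc m)
  note split = descending_word_Suc
  show ?case
  proof (cases "i + 2 \<le> m")
    case True
    have "int i # descending_word (Suc m) = [int i, int m] @ descending_word m"
      using Suc.prems by (simp add: split)
    also have "\<dots> \<doteq> [int m, int i] @ descending_word m"
      using True Suc.prems by (intro braid_eq.append_right braid_eq.far) auto
    also have "\<dots> \<doteq> [int m] @ descending_word m @ [int (Suc i)]"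
      using braid_eq_append_left[OF Suc.IH[OF Suc.prems(1) True], of "[int m]"] by simp
    finally show ?thesis using Suc.prems by (simp add: split)
  next
    case False
    with Suc.prems have m: "m = Suc i" by simp
    have "int i # descending_word (Suc m) = [int i, int i + 1, int i] @ descending_word i"
      using Suc.prems by (simp add: split m add.commute)
    also have "\<dots> \<doteq> [int i + 1, int i, int i + 1] @ descending_word i"
      using Suc.prems by (intro braid_eq.append_right braid_eq.braid) auto
    also have "\<dots> = [int i + 1, int i] @ ((int i + 1) # descending_word i)"
      by simp
    also have "\<dots> \<doteq> [int i + 1, int i] @ (descending_word i @ [int i + 1])"
      by (intro braid_eq_append_left far_commute) (auto simp: set_descending_word)
    finally show ?thesis using Suc.prems by (simp add: split m add.commute)
  qed
qed simp

lemma descending_shift_power: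
  assumes "1 \<le> i" "i + e < m"
  shows "int i # word_power (descending_word m) e \<doteq> word_power (descending_word m) e @ [int (i + e)]"
  using assms
proof (induction e arbitrary: i)
  case (Suc e)
  have "int i # word_power (descending_word m) (Suc e)
      \<doteq> (descending_word m @ [int (Suc i)]) @ word_power (descending_word m) e"
    using braid_eq.append_right[OF descending_shift[of i m]] Suc.prems by simp
  also have "\<dots> \<doteq> descending_word m @ (word_power (descending_word m) e @ [int (Suc i + e)])"
    using braid_eq_append_left[OF Suc.IH[of "Suc i"]] Suc.prems by simp
  finally show ?case by simp
qed simp

lemma descending_shift_word:
  assumes "\<And>a. a \<in> set w \<Longrightarrow> 1 \<le> a \<and> a + 2 \<le> int m"
  shows "w @ descending_word m \<doteq> descending_word m @ map (\<lambda>a. a + 1) w"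
  using assms
proof (induction w)
  case (Cons a w)
  then have a: "1 \<le> a" "a + 2 \<le> int m" by auto
  have "a # w @ descending_word m \<doteq> a # descending_word m @ map (\<lambda>a. a + 1) w"
    using Cons by (intro braid_eq.Cons) auto
  also have "\<dots> \<doteq> (descending_word m @ [a + 1]) @ map (\<lambda>a. a + 1) w"
    using braid_eq.append_right[OF descending_shift[of "nat a" m]] a by (simp add: add.commute)
  finally show ?case by simp
qed simp

text \<open>
  The crossing of the last two places comes out at the first two after two descending words. Write the
  descending word as \<open>d = \<sigma>\<^sub>m\<^sub>-\<^sub>1 u = u' \<sigma>\<^sub>1\<close>. Since \<open>u'\<close> is \<open>u\<close> with all indices raised by one,
  \<open>u d = d u'\<close>, and therefore
  \<open>\<sigma>\<^sub>m\<^sub>-\<^sub>1 d d = \<sigma>\<^sub>m\<^sub>-\<^sub>1 d u' \<sigma>\<^sub>1 = \<sigma>\<^sub>m\<^sub>-\<^sub>1 u d \<sigma>\<^sub>1 = d d \<sigma>\<^sub>1\<close>.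
\<close>

lemma descending_wrap:
  assumes "2 \<le> m"
  shows "int (m - 1) # descending_word m @ descending_word m
      \<doteq> descending_word m @ descending_word m @ [1]"
proof -
  obtain l where m: "m = Suc l" "1 \<le> l" using assms by (cases m) auto
  have tail: "descending_word m = map (\<lambda>a. a + 1) (descending_word l) @ [1]"
  proof -
    have "[1..<Suc l] = 1 # map Suc [1..<l]"
      using m(2) by (simp add: map_Suc_upt upt_conv_Cons del: upt_Suc)
    then show ?thesis by (simp add: descending_word_def m(1) rev_map o_def add.commute)
  qed
  have "int (m - 1) # descending_word m @ descending_word m
      = int l # (descending_word m @ map (\<lambda>a. a + 1) (descending_word l)) @ [1]"
    by (subst (2) tail) (simp add: m)
  also have "\<dots> \<doteq> int l # (descending_word l @ descending_word m) @ [1]"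
    by (intro braid_eq.Cons braid_eq.append_right descending_shift_word[THEN braid_eq.symmetric])
       (auto simp: set_descending_word m)
  also have "\<dots> = descending_word m @ descending_word m @ [1]"
    using m by (simp add: descending_word_Suc)
  finally show ?thesis .
qed

text \<open>
  A letter travels once around: up to index \<open>m - 1\<close>, then in two steps to index \<open>1\<close>, and up to its old
  value. This takes \<open>(m - 1 - i) + 2 + (i - 1) = m\<close> descending words.
\<close>

lemma full_twist_central:
  assumes "1 \<le> i" "i < m"
  shows "int i # word_power (descending_word m) m \<doteq> word_power (descending_word m) m @ [int i]"
proof -
  let ?d = "descending_word m"
  obtain a b where ab: "a = m - 1 - i" "b = i - 1" by blast
  have m: "m = a + (2 + b)" using assms ab by simp
  have two: "word_power ?d 2 = ?d @ ?d" by (simp add: numeral_2_eq_2)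
  have split: "word_power ?d m = word_power ?d a @ word_power ?d 2 @ word_power ?d b"
    by (simp only: word_power_add[symmetric] m[symmetric])
  have "int i # word_power ?d m
      = (int i # word_power ?d a) @ word_power ?d 2 @ word_power ?d b"
    by (simp only: split append_Cons)
  also have "\<dots> \<doteq> (word_power ?d a @ [int (m - 1)]) @ word_power ?d 2 @ word_power ?d b"
    using descending_shift_power[of i a m] assms ab by (intro braid_eq.append_right) auto
  also have "\<dots> = word_power ?d a @ (int (m - 1) # ?d @ ?d) @ word_power ?d b"
    by (simp add: two)
  also have "\<dots> \<doteq> word_power ?d a @ (?d @ ?d @ [1]) @ word_power ?d b"
    using descending_wrap[of m] assms by (intro braid_eq_append_left braid_eq.append_right) auto
  also have "\<dots> = word_power ?d a @ word_power ?d 2 @ (int 1 # word_power ?d b)"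
    by (simp add: two)
  also have "\<dots> \<doteq> word_power ?d a @ word_power ?d 2 @ (word_power ?d b @ [int (1 + b)])"
    using descending_shift_power[of 1 b m] assms ab by (intro braid_eq_append_left) auto
  also have "\<dots> = word_power ?d m @ [int i]"
  proof -
    have "1 + b = i" using assms ab by simp
    then show ?thesis by (simp only: split append_assoc)
  qed
  finally show ?thesis .
qed

definition positive_word :: "nat \<Rightarrow> braid_word \<Rightarrow> bool" where
  "positive_word m w \<longleftrightarrow> (\<forall>a\<in>set w. 1 \<le> a \<and> a < int m)"

lemma positive_word_append [simp]:
  "positive_word m (v @ w) \<longleftrightarrow> positive_word m v \<and> positive_word m w"
  by (auto simp: positive_word_def)

lemma positive_word_power: "positive_word m w \<Longrightarrow> positive_word m (word_power w n)"
  by (auto simp: positive_word_def)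

lemma positive_word_mono: "positive_word m w \<Longrightarrow> m \<le> n \<Longrightarrow> positive_word n w"
  unfolding positive_word_def by (meson less_le_trans of_nat_le_iff)

lemma positive_descending_word: "positive_word m (descending_word m)"
  by (auto simp: positive_word_def set_descending_word)

lemma full_twist_commutes:
  assumes "positive_word m w"
  shows "w @ word_power (descending_word m) m \<doteq> word_power (descending_word m) m @ w"
proof (rule word_commute)
  fix a assume "a \<in> set w"
  with assms have "1 \<le> a" "a < int m" by (auto simp: positive_word_def)
  then show "a # word_power (descending_word m) m \<doteq> word_power (descending_word m) m @ [a]"
    using full_twist_central[of "nat a" m] by auto
qed

text \<open>
  With \<open>D\<close> and \<open>d\<close> the descending words on \<open>m + 1\<close> and \<open>m\<close> strands, \<open>D = \<sigma>\<^sub>m d\<close>; moving \<open>\<sigma>\<^sub>m\<close> to the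
  front through \<open>D\<^sup>e\<close> lowers its index to \<open>m - e\<close>, so \<open>D\<^sup>e D = \<sigma>\<^sub>m\<^sub>-\<^sub>e D\<^sup>e d\<close>.
\<close>

lemma descending_power_Suc_strands:
  assumes "e \<le> m"
  shows "word_power (descending_word (Suc m)) e
      \<doteq> map int [Suc m - e..<Suc m] @ word_power (descending_word m) e"
  using assms
proof (induction e)
  case (Suc e)
  let ?D = "descending_word (Suc m)" and ?d = "descending_word m"
  have "word_power ?D (Suc e) = (word_power ?D e @ [int m]) @ ?d"
    unfolding word_power_Suc_right using Suc.prems by (simp add: descending_word_Suc)
  also have "\<dots> \<doteq> (int (m - e) # word_power ?D e) @ ?d"
    using descending_shift_power[of "m - e" e "Suc m", THEN braid_eq.symmetric] Suc.prems
    by (intro braid_eq.append_right) auto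
  also have "\<dots> \<doteq> (int (m - e) # map int [Suc m - e..<Suc m] @ word_power ?d e) @ ?d"
    using Suc by (intro braid_eq.append_right braid_eq.Cons) auto
  also have "\<dots> = (int (m - e) # map int [Suc m - e..<Suc m]) @ word_power ?d (Suc e)"
    unfolding word_power_Suc_right by simp
  also have "int (m - e) # map int [Suc m - e..<Suc m] = map int [Suc m - Suc e..<Suc m]"
    using Suc.prems by (simp add: Suc_diff_le upt_conv_Cons del: upt_Suc)
  finally show ?case .
qed simp

lemma positive_ascending: "e \<le> m \<Longrightarrow> positive_word (Suc m) (map int [Suc m - e..<Suc m])"
  by (auto simp: positive_word_def)

text \<open>
  In the \<open>e\<close>-th power, \<open>e\<close> strands pass under the other \<open>m - e\<close> and make a full twist among themselves.
\<close>

lemma descending_power_splits_full_twist: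
  assumes "e \<le> m"
  shows "\<exists>X. positive_word m X \<and>
    word_power (descending_word m) e \<doteq> X @ word_power (descending_word e) e"
  using assms
proof (induction m rule: dec_induct)
  case base
  show ?case by (intro exI[of _ "[]"]) (simp add: positive_word_def)
next
  case (step m)
  then obtain X where X: "positive_word m X"
    "word_power (descending_word m) e \<doteq> X @ word_power (descending_word e) e" by blast
  have "word_power (descending_word (Suc m)) e
      \<doteq> map int [Suc m - e..<Suc m] @ word_power (descending_word m) e"
    by (rule descending_power_Suc_strands) (use step in simp)
  also have "\<dots> \<doteq> map int [Suc m - e..<Suc m] @ X @ word_power (descending_word e) e"
    by (intro braid_eq_append_left X)
  finally show ?case
    using X positive_ascending[of e m] step positive_word_mono[of m X "Suc m"]
    by (intro exI[of _ "map int [Suc m - e..<Suc m] @ X"]) auto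
qed

text \<open>
  The case \<open>e = m\<close> of \<open>descending_power_Suc_strands\<close> removes one strand from all but one of the \<open>m + 1\<close>
  factors of a full twist; the factor that is left over is positive.
\<close>

lemma full_twist_splits_full_twist:
  assumes "r \<le> m"
  shows "\<exists>Y. positive_word m Y \<and>
    word_power (descending_word m) m \<doteq> Y @ word_power (descending_word r) r"
  using assms
proof (induction m rule: dec_induct)
  case base
  show ?case by (intro exI[of _ "[]"]) (simp add: positive_word_def)
next
  case (step m)
  then obtain Y where Y: "positive_word m Y"
    "word_power (descending_word m) m \<doteq> Y @ word_power (descending_word r) r" by blast
  let ?D = "descending_word (Suc m)" and ?a = "map int [Suc m - m..<Suc m]"
  have "word_power ?D (Suc m) = ?D @ word_power ?D m" by simp
  also have "\<dots> \<doteq> ?D @ ?a @ word_power (descending_word m) m"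
    by (intro braid_eq_append_left descending_power_Suc_strands) simp
  also have "\<dots> \<doteq> ?D @ ?a @ Y @ word_power (descending_word r) r"
    by (intro braid_eq_append_left Y)
  finally show ?case
    using Y positive_ascending[of m m] positive_word_mono[of m Y "Suc m"]
      positive_descending_word[of "Suc m"]
    by (intro exI[of _ "?D @ ?a @ Y"]) auto
qed

text \<open>
  Here \<open>D\<close> is the full twist on fewer strands. Centrality of the big twist is what allows to move the
  cofactor \<open>Y\<close> out of the way, so that the next twist meets the next \<open>D'\<close>.
\<close>

lemma full_twists_untwist:
  assumes Y: "word_power (descending_word m) m \<doteq> Y @ D" "positive_word m Y"
    and D: "D @ D' \<doteq> []"
  shows "word_power (word_power (descending_word m) m) n @ word_power D' n \<doteq> word_power Y n"
proof (induction n)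
  case (Suc n)
  let ?c = "word_power (descending_word m) m"
  have "word_power ?c (Suc n) @ word_power D' (Suc n)
      = word_power ?c n @ ?c @ D' @ word_power D' n"
    unfolding word_power_Suc_right[of n ?c] by simp
  also have "\<dots> \<doteq> word_power ?c n @ (Y @ D) @ D' @ word_power D' n"
    by (intro braid_eq_append_left braid_eq.append_right Y)
  also have "\<dots> = (word_power ?c n @ Y) @ (D @ D') @ word_power D' n" by simp
  also have "\<dots> \<doteq> (Y @ word_power ?c n) @ [] @ word_power D' n"
    by (intro braid_eq_append D braid_eq.reflexive commute_power[THEN braid_eq.symmetric] full_twist_commutes Y)
  also have "\<dots> = Y @ (word_power ?c n @ word_power D' n)" by simp
  also have "\<dots> \<doteq> Y @ word_power Y n"
    by (intro braid_eq_append_left Suc)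
  finally show ?case by simp
qed simp

lemma twisted_torus_word_positive:
  assumes "r \<le> q" and pke: "p = k * q + e" and "e < q"
    and n: "n < k + 1 \<or> (n = k + 1 \<and> r \<le> e)"
  shows "\<exists>w. positive_word q w \<and>
    braid_power (descending_word q) (int p) @ braid_power (descending_word r) (int r * - int n) \<doteq> w"
proof -
  let ?d = "descending_word q" and ?D = "word_power (descending_word r) r"
  let ?D' = "word_power (braid_inverse (descending_word r)) r"
  let ?c = "word_power ?d q"
  have DD': "?D @ ?D' \<doteq> []"
    by (rule cancel_inverse_power) (auto simp: set_descending_word)
  have "braid_power (descending_word r) (int r * - int n) = word_power ?D' n"
    by (simp only: braid_power_negative word_power_mult)
  moreover have "braid_power ?d (int p) = word_power ?d p"
    by (simp add: braid_power_def)
  moreover have "\<exists>w. positive_word q w \<and> word_power ?d p @ word_power ?D' n \<doteq> w"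
  proof -
    obtain Y where Y: "?c \<doteq> Y @ ?D" "positive_word q Y"
      using full_twist_splits_full_twist[OF \<open>r \<le> q\<close>] by blast
    note untwist = full_twists_untwist[OF Y DD']
    consider "n \<le> k" | "n = k + 1" "r \<le> e" using n by linarith
    then show ?thesis
    proof cases
      case 1
      have "q * (k - n) + q * n = q * k"
        using 1 by (metis add_mult_distrib2 le_add_diff_inverse2)
      then have p: "p = (e + q * (k - n)) + q * n"
        by (simp add: pke mult.commute)
      have "word_power ?d p @ word_power ?D' n
          = word_power ?d (e + q * (k - n)) @ (word_power ?c n @ word_power ?D' n)"
        unfolding word_power_mult by (subst p) (simp only: word_power_add append_assoc)
      also have "\<dots> \<doteq> word_power ?d (e + q * (k - n)) @ word_power Y n"
        by (intro braid_eq_append_left untwist)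
      finally show ?thesis
        using Y(2) positive_descending_word[of q]
        by (intro exI[of _ "word_power ?d (e + q * (k - n)) @ word_power Y n"])
           (simp add: positive_word_power)
    next
      case 2
      obtain X where X: "word_power ?d e \<doteq> X @ word_power (descending_word e) e" "positive_word q X"
        using descending_power_splits_full_twist[of e q] \<open>e < q\<close> by auto
      obtain X' where X': "word_power (descending_word e) e \<doteq> X' @ ?D" "positive_word e X'"
        using full_twist_splits_full_twist[OF 2(2)] by blast
      have Z: "positive_word q (X @ X')"
        using X X' positive_word_mono[of e X' q] \<open>e < q\<close> by auto
      have p: "p = q * k + e" by (simp add: pke mult.commute)
      have "word_power ?d p @ word_power ?D' n
          = word_power ?c k @ word_power ?d e @ ?D' @ word_power ?D' k"
        unfolding word_power_mult 2(1) p by (simp add: word_power_add)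
      also have "\<dots> \<doteq> word_power ?c k @ (X @ X' @ ?D) @ ?D' @ word_power ?D' k"
        by (intro braid_eq_append_left braid_eq.append_right braid_eq.transitive[OF X(1)] X')
      also have "\<dots> = (word_power ?c k @ X @ X') @ (?D @ ?D') @ word_power ?D' k"
        by simp
      also have "\<dots> \<doteq> ((X @ X') @ word_power ?c k) @ [] @ word_power ?D' k"
        by (intro braid_eq_append DD' braid_eq.reflexive commute_power[THEN braid_eq.symmetric]
            full_twist_commutes Z)
      also have "\<dots> = (X @ X') @ (word_power ?c k @ word_power ?D' k)" by simp
      also have "\<dots> \<doteq> (X @ X') @ word_power Y k"
        by (intro braid_eq_append_left untwist)
      finally show ?thesis
        using Z Y(2) by (intro exI[of _ "(X @ X') @ word_power Y k"]) (simp add: positive_word_power)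
    qed
  qed
  ultimately show ?thesis by simp
qed

section \<open>Braids as motions of points in the plane\<close>

text \<open>
  Labels start from 1, like the strand positions. The closing arcs return at the same heights in the
  half-plane \<open>x < 0\<close>; points with positive real part never meet them.
\<close>

definition config_space :: "(nat \<Rightarrow> complex) set" where
  "config_space = {c. inj_on c {1..} \<and> (\<forall>k\<ge>1. 0 < Re (c k))}"

lemma config_spaceI:
  assumes "\<And>k. 1 \<le> k \<Longrightarrow> 0 < Re (c k)"
    and "\<And>j k. 1 \<le> j \<Longrightarrow> 1 \<le> k \<Longrightarrow> j < k \<Longrightarrow> c j \<noteq> c k"
  shows "c \<in> config_space"
proof -
  have "inj_on c {1..}" by (rule linorder_inj_onI) (use assms(2) in auto)
  then show ?thesis using assms(1) by (simp add: config_space_def)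
qed

lemma config_spaceD:
  assumes "c \<in> config_space" "1 \<le> j"
  shows "0 < Re (c j)" "1 \<le> k \<Longrightarrow> j \<noteq> k \<Longrightarrow> c j \<noteq> c k"
  using assms by (auto simp: config_space_def inj_on_def)

definition letter_perm :: "int \<Rightarrow> nat \<Rightarrow> nat" where
  "letter_perm a k =
     (if k = nat \<bar>a\<bar> then Suc (nat \<bar>a\<bar>) else if k = Suc (nat \<bar>a\<bar>) then nat \<bar>a\<bar> else k)"

definition over_pos :: "int \<Rightarrow> nat" where
  "over_pos a = (if a > 0 then nat \<bar>a\<bar> else Suc (nat \<bar>a\<bar>))"

lemma letter_perm_involution [simp]: "letter_perm a (letter_perm a k) = k"
  by (auto simp: letter_perm_def)

lemma letter_perm_ge_1: "a \<noteq> 0 \<Longrightarrow> 1 \<le> k \<Longrightarrow> 1 \<le> letter_perm a k"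
  by (auto simp: letter_perm_def)

lemma letter_perm_eq_iff [simp]: "letter_perm a j = letter_perm a k \<longleftrightarrow> j = k"
  by (metis letter_perm_involution)

text \<open>
  A schedule tells which part of the exchange of two strands has taken place at a given time of a letter.
\<close>

definition crossing_schedule :: "(real \<Rightarrow> real) \<Rightarrow> bool" where
  "crossing_schedule \<phi> \<longleftrightarrow>
     continuous_on UNIV \<phi> \<and> \<phi> 0 = 0 \<and> \<phi> 1 = 1 \<and> (\<forall>u\<in>{0..1}. \<phi> u \<in> {0..1})"

lemma crossing_schedule_id: "crossing_schedule (\<lambda>u. u)"
  by (simp add: crossing_schedule_def)

text \<open>
  The point in position \<open>k\<close> during the letter \<open>a\<close>. The schedule governs the horizontal coordinate only;
  the over-strand always rises linearly to \<open>z = 1\<close> and falls back. The identity schedule gives the shape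
  used in \<open>letter_strands\<close>.
\<close>

definition strand :: "(real \<Rightarrow> real) \<Rightarrow> int \<Rightarrow> real \<Rightarrow> nat \<Rightarrow> complex" where
  "strand \<phi> a u k = Complex (real k + \<phi> u * (real (letter_perm a k) - real k))
                             (if k = over_pos a then 1 - \<bar>2 * u - 1\<bar> else 0)"

lemma Complex_of_nat: "Complex (real k) 0 = of_nat k"
  by (simp add: complex_eq_iff)

lemma strand_ends:
  assumes "crossing_schedule \<phi>"
  shows "strand \<phi> a 0 k = of_nat k" "strand \<phi> a 1 k = of_nat (letter_perm a k)"
  using assms by (simp_all add: strand_def crossing_schedule_def Complex_of_nat)

lemma continuous_strand:
  assumes "crossing_schedule \<phi>" shows "continuous_on S (\<lambda>u. strand \<phi> a u k)"
proof -
  have "continuous_on S \<phi>"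
    using assms continuous_on_subset by (auto simp: crossing_schedule_def)
  then have "continuous_on S (\<lambda>u. Complex (real k + \<phi> u * (real (letter_perm a k) - real k))
                             (if k = over_pos a then 1 - \<bar>2 * u - 1\<bar> else 0))"
    by (cases "k = over_pos a") (auto intro!: continuous_intros)
  then show ?thesis by (simp add: strand_def)
qed

text \<open>
  Only the two strands of the letter can ever agree horizontally, and they do so strictly inside the time
  interval, where the over-strand is lifted.
\<close>

lemma strand_crossing:
  assumes \<phi>: "crossing_schedule \<phi>" and u: "u \<in> {0..1}" and "j \<noteq> k"
    and Re: "Re (strand \<phi> a u j) = Re (strand \<phi> a u k)"
  shows "k = letter_perm a j" "\<phi> u = 1/2" "0 < u" "u < 1"
proof -
  let ?i = "nat \<bar>a\<bar>"
  have u1: "0 \<le> \<phi> u" "\<phi> u \<le> 1" using \<phi> u by (auto simp: crossing_schedule_def)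
  have bound: "real ?i \<le> Re (strand \<phi> a u l) \<and> Re (strand \<phi> a u l) \<le> real ?i + 1"
    if "l = ?i \<or> l = Suc ?i" for l
    using that u1 by (auto simp: strand_def letter_perm_def)
  have fixed: "Re (strand \<phi> a u l) = real l" if "l \<noteq> ?i" "l \<noteq> Suc ?i" for l
    using that by (auto simp: strand_def letter_perm_def)
  have in_or: "l < ?i \<or> ?i + 1 < l" if "l \<noteq> ?i" "l \<noteq> Suc ?i" for l
    using that by linarith
  have lt: "real l < real ?i \<or> real ?i + 1 < real l" if "l \<noteq> ?i" "l \<noteq> Suc ?i" for l
    using in_or[OF that] by linarith
  have J: "j = ?i \<or> j = Suc ?i"
  proof (rule ccontr)
    assume "\<not> ?thesis"
    then show False
      using fixed[of j] fixed[of k] lt[of j] bound[of k] Re \<open>j \<noteq> k\<close> by force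
  qed
  have K: "k = ?i \<or> k = Suc ?i"
  proof (rule ccontr)
    assume "\<not> ?thesis"
    then show False
      using fixed[of k] lt[of k] bound[of j] J Re by force
  qed
  show "k = letter_perm a j" using J K \<open>j \<noteq> k\<close> by (auto simp: letter_perm_def)
  show half: "\<phi> u = 1/2" using J K \<open>j \<noteq> k\<close> Re by (auto simp: strand_def letter_perm_def)
  have "u \<noteq> 0" "u \<noteq> 1" using half \<phi> by (auto simp: crossing_schedule_def)
  then show "0 < u" "u < 1" using u by auto
qed

lemma over_pos_cases: "letter_perm a j = k \<Longrightarrow> j \<noteq> k \<Longrightarrow> j = over_pos a \<or> k = over_pos a"
  by (auto simp: letter_perm_def over_pos_def split: if_splits)

lemma letter_perm_over_pos: "letter_perm a (over_pos a) \<noteq> over_pos a"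
  by (auto simp: letter_perm_def over_pos_def)

lemma strand_in_config_space:
  assumes \<phi>: "crossing_schedule \<phi>" and u: "u \<in> {0..1}" and a: "a \<noteq> 0"
  shows "strand \<phi> a u \<in> config_space"
proof (rule config_spaceI)
  fix k :: nat assume "1 \<le> k"
  have u1: "0 \<le> \<phi> u" "\<phi> u \<le> 1" using \<phi> u by (auto simp: crossing_schedule_def)
  have "Re (strand \<phi> a u k) = (1 - \<phi> u) * real k + \<phi> u * real (letter_perm a k)"
    by (simp add: strand_def algebra_simps)
  also have "\<dots> \<ge> (1 - \<phi> u) * 1 + \<phi> u * 1"
    using u1 \<open>1 \<le> k\<close> letter_perm_ge_1[OF a \<open>1 \<le> k\<close>] by (intro add_mono mult_left_mono) auto
  finally show "0 < Re (strand \<phi> a u k)" by simp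
next
  fix j k :: nat assume jk: "j < k"
  show "strand \<phi> a u j \<noteq> strand \<phi> a u k"
  proof
    assume eq: "strand \<phi> a u j = strand \<phi> a u k"
    then have *: "k = letter_perm a j" "0 < u" "u < 1"
      using strand_crossing[OF \<phi> u, of j k a] jk by auto
    then have "Im (strand \<phi> a u j) \<noteq> Im (strand \<phi> a u k)"
      using over_pos_cases[of a j k] jk by (auto simp: strand_def)
    with eq show False by simp
  qed
qed

lemma config_space_relabel:
  assumes "c \<in> config_space" "a \<noteq> 0" shows "(\<lambda>k. c (letter_perm a k)) \<in> config_space"
proof (rule config_spaceI)
  fix k :: nat assume "1 \<le> k"
  then show "0 < Re (c (letter_perm a k))"
    by (intro config_spaceD(1) assms letter_perm_ge_1)
next
  fix j k :: nat assume "1 \<le> j" "1 \<le> k" "j < k"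
  then show "c (letter_perm a j) \<noteq> c (letter_perm a k)"
    by (intro config_spaceD(2) assms letter_perm_ge_1) auto
qed

fun end_pos :: "braid_word \<Rightarrow> nat \<Rightarrow> nat" where
  "end_pos [] k = k"
| "end_pos (a # w) k = end_pos w (letter_perm a k)"

text \<open>
  Strands are labelled by their start positions, and every letter takes one unit of time.
\<close>

fun braid_motion :: "(real \<Rightarrow> real) \<Rightarrow> braid_word \<Rightarrow> real \<Rightarrow> nat \<Rightarrow> complex" where
  "braid_motion \<phi> [] y k = of_nat k"
| "braid_motion \<phi> (a # w) y k =
     (if y \<le> 1 then strand \<phi> a y k else braid_motion \<phi> w (y - 1) (letter_perm a k))"

lemma end_pos_append: "end_pos (v @ w) k = end_pos w (end_pos v k)"
  by (induction v arbitrary: k) auto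

lemma end_pos_ge_1: "0 \<notin> set w \<Longrightarrow> 1 \<le> k \<Longrightarrow> 1 \<le> end_pos w k"
  by (induction w arbitrary: k) (use letter_perm_ge_1 in auto)

lemma inj_end_pos: "inj (end_pos w)"
proof (induction w)
  case Nil
  have "end_pos [] = id" by auto
  then show ?case by simp
next
  case (Cons a w)
  then show ?case unfolding inj_def by (metis end_pos.simps(2) letter_perm_eq_iff)
qed

lemma of_nat_config: "of_nat \<in> config_space"
  by (rule config_spaceI) auto

lemma braid_motion_0: "crossing_schedule \<phi> \<Longrightarrow> braid_motion \<phi> w 0 k = of_nat k"
  by (cases w) (auto simp: strand_ends)

lemma braid_motion_length:
  assumes "crossing_schedule \<phi>" shows "braid_motion \<phi> w (real (length w)) k = of_nat (end_pos w k)"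
  by (induction w arbitrary: k) (auto simp: strand_ends[OF assms])

lemma continuous_braid_motion:
  assumes "crossing_schedule \<phi>" shows "continuous_on S (\<lambda>y. braid_motion \<phi> w y k)"
proof (induction w arbitrary: k S)
  case (Cons a w)
  have "continuous_on T (\<lambda>y. braid_motion \<phi> w (y - 1) l)" for T l
    by (rule continuous_on_compose2[OF Cons.IH[of UNIV l]]) (auto intro!: continuous_intros)
  then have "continuous_on S
     (\<lambda>y. if y \<le> 1 then strand \<phi> a y k else braid_motion \<phi> w (y - 1) (letter_perm a k))"
    by (intro continuous_on_cases_le continuous_intros continuous_strand assms)
       (auto simp: strand_ends[OF assms] braid_motion_0[OF assms])
  then show ?case by simp
qed simp

lemma braid_motion_in_config_space:
  assumes "crossing_schedule \<phi>" "0 \<notin> set w" "0 \<le> y" "y \<le> real (length w)"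
  shows "braid_motion \<phi> w y \<in> config_space"
  using assms(2-)
proof (induction w arbitrary: y)
  case (Cons a w)
  show ?case
  proof (cases "y \<le> 1")
    case True
    have "braid_motion \<phi> (a # w) y = strand \<phi> a y" using True by auto
    with True Cons.prems show ?thesis
      using strand_in_config_space[OF assms(1), of y a] by auto
  next
    case False
    have "braid_motion \<phi> (a # w) y = (\<lambda>k. braid_motion \<phi> w (y - 1) (letter_perm a k))"
      using False by auto
    with False Cons show ?thesis by (auto intro!: config_space_relabel)
  qed
next
  case Nil
  have "braid_motion \<phi> [] y = of_nat" by auto
  then show ?case by (simp add: of_nat_config)
qed

section \<open>Homotopies of motions\<close>

lemma path_coordinatewise:
  fixes p :: "real \<Rightarrow> nat \<Rightarrow> complex"
  shows "path p \<longleftrightarrow> (\<forall>k. continuous_on {0..1} (\<lambda>u. p u k))"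
  unfolding path_def
  by (auto intro: continuous_on_coordinatewise_then_product continuous_on_product_then_coordinatewise)

lemma homotopic_paths_straight:
  fixes p q :: "real \<Rightarrow> nat \<Rightarrow> complex"
  assumes "path p" "path q" "p 0 = q 0" "p 1 = q 1"
    and C: "\<And>t u. t \<in> {0..1} \<Longrightarrow> u \<in> {0..1} \<Longrightarrow>
      (\<lambda>k. (1 - t) *\<^sub>R p u k + t *\<^sub>R q u k) \<in> C"
  shows "homotopic_paths C p q"
proof -
  have cont: "continuous_on ({0..1} \<times> {0..1}) (\<lambda>x. p (snd x) k)"
    "continuous_on ({0..1} \<times> {0..1}) (\<lambda>x. q (snd x) k)" for k
    using assms(1,2) unfolding path_coordinatewise
    by (auto intro!: continuous_on_compose2[where f=snd and t="{0..1}"] continuous_intros)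
  show ?thesis
    unfolding homotopic_paths
    by (rule exI[of _ "\<lambda>x k. (1 - fst x) *\<^sub>R p (snd x) k + fst x *\<^sub>R q (snd x) k"])
       (use assms C in \<open>auto simp: pathstart_def pathfinish_def algebra_simps
          simp flip: scaleR_add_left
          intro!: continuous_on_coordinatewise_then_product continuous_intros cont\<close>)
qed

text \<open>
  Where two strands cross in projection, the one of higher level is above.
\<close>

definition ordered_by :: "(nat \<Rightarrow> real) \<Rightarrow> (real \<Rightarrow> nat \<Rightarrow> complex) \<Rightarrow> bool" where
  "ordered_by lev p \<longleftrightarrow> (\<forall>u\<in>{0..1}. \<forall>j\<ge>1. \<forall>k\<ge>1.
     Re (p u j) = Re (p u k) \<and> lev j < lev k \<longrightarrow> Im (p u j) < Im (p u k))"

lemma config_space_convex_same_Re: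
  assumes "c \<in> config_space" "\<And>k. Re (c k) = Re (d k)" "t \<in> {0..1}"
    and "\<And>j k. 1 \<le> j \<Longrightarrow> 1 \<le> k \<Longrightarrow> j \<noteq> k \<Longrightarrow> Re (c j) = Re (c k) \<Longrightarrow>
      Im (c j) < Im (c k) \<and> Im (d j) < Im (d k) \<or> Im (c k) < Im (c j) \<and> Im (d k) < Im (d j)"
  shows "(\<lambda>k. (1 - t) *\<^sub>R c k + t *\<^sub>R d k) \<in> config_space"
proof (rule config_spaceI)
  fix k :: nat assume "1 \<le> k"
  then show "0 < Re ((1 - t) *\<^sub>R c k + t *\<^sub>R d k)"
    using config_spaceD(1)[OF assms(1)] by (simp add: assms(2)[symmetric] algebra_simps)
next
  fix j k :: nat assume jk: "1 \<le> j" "1 \<le> k" "j < k"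
  have lt: "(1 - t) * x + t * x' < (1 - t) * y + t * y'" if "x < y" "x' < y'" for x y x' y' :: real
  proof (cases "t = 1")
    case False
    with that assms(3) show ?thesis
      by (intro add_less_le_mono mult_strict_left_mono mult_left_mono) auto
  qed (use that in simp)
  show "(1 - t) *\<^sub>R c j + t *\<^sub>R d j \<noteq> (1 - t) *\<^sub>R c k + t *\<^sub>R d k"
  proof
    assume eq: "(1 - t) *\<^sub>R c j + t *\<^sub>R d j = (1 - t) *\<^sub>R c k + t *\<^sub>R d k"
    have "Re (c j) = Re (c k)"
      using arg_cong[OF eq, of Re] by (simp add: assms(2)[symmetric] algebra_simps)
    from assms(4)[OF jk(1,2) _ this] jk(3) show False
      using arg_cong[OF eq, of Im] lt[of "Im (c j)" "Im (c k)" "Im (d j)" "Im (d k)"]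
        lt[of "Im (c k)" "Im (c j)" "Im (d k)" "Im (d j)"] by auto
  qed
qed

text \<open>
  Each path is deformed, without moving the projection, until every strand runs at the depth given by its
  level; crossings do not obstruct this because the order is the same before and after. The two deformed
  paths differ only in their projections, and strands at different depths pass each other freely.
\<close>

lemma homotopic_paths_layered:
  fixes p q :: "real \<Rightarrow> nat \<Rightarrow> complex"
  assumes p: "path p" "\<And>u. u \<in> {0..1} \<Longrightarrow> p u \<in> config_space" "ordered_by lev p"
    and q: "path q" "\<And>u. u \<in> {0..1} \<Longrightarrow> q u \<in> config_space" "ordered_by lev q"
    and ends: "p 0 = q 0" "p 1 = q 1" "\<And>k. Im (p 0 k) = 0" "\<And>k. Im (p 1 k) = 0"
    and lev: "inj lev"
  shows "homotopic_paths config_space p q"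
proof -
  \<comment> \<open>The factor \<open>min u (1 - u)\<close> vanishes exactly at both ends, which therefore stay fixed.\<close>
  define flat where "flat r u k = Complex (Re (r u k)) (min u (1 - u) * lev k)"
    for r :: "real \<Rightarrow> nat \<Rightarrow> complex" and u k
  have path_flat: "path (flat r)" if "path r" for r
    using that unfolding path_coordinatewise flat_def
    by (auto intro!: continuous_on_Complex continuous_intros)
  have flat_ends: "flat r 0 = r 0" "flat r 1 = r 1"
    if "\<And>k. Im (r 0 k) = 0" "\<And>k. Im (r 1 k) = 0" for r
    using that by (auto simp: flat_def complex_eq_iff)
  have to_flat: "homotopic_paths config_space r (flat r)"
    if r: "path r" "\<And>u. u \<in> {0..1} \<Longrightarrow> r u \<in> config_space" "ordered_by lev r"
      "\<And>k. Im (r 0 k) = 0" "\<And>k. Im (r 1 k) = 0" for r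
  proof (rule homotopic_paths_straight)
    show "path r" "path (flat r)" using r path_flat by auto
    show "r 0 = flat r 0" "r 1 = flat r 1" using flat_ends[of r] r by auto
    fix t u :: real assume t: "t \<in> {0..1}" and u: "u \<in> {0..1}"
    show "(\<lambda>k. (1 - t) *\<^sub>R r u k + t *\<^sub>R flat r u k) \<in> config_space"
    proof (cases "u = 0 \<or> u = 1")
      case True
      then have "flat r u = r u" using flat_ends[of r] r by auto
      then have "(\<lambda>k. (1 - t) *\<^sub>R r u k + t *\<^sub>R flat r u k) = r u"
        by (auto simp: algebra_simps simp flip: scaleR_add_left)
      then show ?thesis using r(2)[OF u] by simp
    next
      case False
      then have pos: "0 < min u (1 - u)" using u by auto
      show ?thesis
      proof (rule config_space_convex_same_Re[OF r(2)[OF u] _ t])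
        fix j k :: nat assume jk: "1 \<le> j" "1 \<le> k" "j \<noteq> k" and Re: "Re (r u j) = Re (r u k)"
        have "lev j \<noteq> lev k" using lev jk(3) by (auto simp: inj_def)
        then consider "lev j < lev k" | "lev k < lev j" by linarith
        then show "Im (r u j) < Im (r u k) \<and> Im (flat r u j) < Im (flat r u k) \<or>
            Im (r u k) < Im (r u j) \<and> Im (flat r u k) < Im (flat r u j)"
          using r(3) u jk Re pos unfolding ordered_by_def
          by cases (auto simp: flat_def intro!: mult_strict_left_mono)
      qed (simp add: flat_def)
    qed
  qed
  have middle: "homotopic_paths config_space (flat p) (flat q)"
  proof (rule homotopic_paths_straight)
    show "path (flat p)" "path (flat q)" using p q path_flat by auto
    show "flat p 0 = flat q 0" "flat p 1 = flat q 1" using ends by (auto simp: flat_def)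
    fix t u :: real assume t: "t \<in> {0..1}" and u: "u \<in> {0..1}"
    show "(\<lambda>k. (1 - t) *\<^sub>R flat p u k + t *\<^sub>R flat q u k) \<in> config_space"
    proof (cases "u = 0 \<or> u = 1")
      case True
      then have "flat p u = p u" "flat q u = p u"
        using flat_ends[of p] flat_ends[of q] ends by auto
      then have "(\<lambda>k. (1 - t) *\<^sub>R flat p u k + t *\<^sub>R flat q u k) = p u"
        by (auto simp: algebra_simps simp flip: scaleR_add_left)
      then show ?thesis using p(2)[OF u] by simp
    next
      case False
      then have pos: "0 < min u (1 - u)" using u by auto
      show ?thesis
      proof (rule config_spaceI)
        fix k :: nat assume "1 \<le> k"
        then have "0 < Re (p u k)" "0 < Re (q u k)" using p(2) q(2) u config_spaceD(1) by auto
        then have "0 < (1 - t) * Re (p u k) + t * Re (q u k)"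
          using t by (cases "t = 0") (auto intro!: add_nonneg_pos)
        then show "0 < Re ((1 - t) *\<^sub>R flat p u k + t *\<^sub>R flat q u k)" by (simp add: flat_def)
      next
        fix j k :: nat assume "j < k"
        then have "min u (1 - u) * lev j \<noteq> min u (1 - u) * lev k"
          using lev pos by (auto simp: inj_def)
        moreover have "Im ((1 - t) *\<^sub>R flat p u l + t *\<^sub>R flat q u l) = min u (1 - u) * lev l" for l
          by (simp add: flat_def algebra_simps)
        ultimately show "(1 - t) *\<^sub>R flat p u j + t *\<^sub>R flat q u j \<noteq>
            (1 - t) *\<^sub>R flat p u k + t *\<^sub>R flat q u k" by metis
      qed
    qed
  qed
  show ?thesis
    using to_flat[OF p ends(3,4)] middle to_flat[OF q] ends homotopic_paths_sym homotopic_paths_trans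
    by metis
qed

section \<open>Braid relations are homotopies\<close>

text \<open>
  The same motion as \<open>braid_motion\<close> up to timing; joining paths makes the calculus of homotopy classes of
  paths available.
\<close>

primrec braid_path :: "braid_word \<Rightarrow> real \<Rightarrow> nat \<Rightarrow> complex" where
  "braid_path [] = (\<lambda>u. of_nat)"
| "braid_path (a # w) = strand (\<lambda>u. u) a +++ (\<lambda>u k. braid_path w u (letter_perm a k))"

lemma homotopic_paths_relabel:
  assumes "homotopic_paths config_space p q" "0 \<notin> set w"
  shows "homotopic_paths config_space (\<lambda>u k. p u (end_pos w k)) (\<lambda>u k. q u (end_pos w k))"
proof -
  have "homotopic_paths config_space ((\<lambda>c k. c (end_pos w k)) \<circ> p) ((\<lambda>c k. c (end_pos w k)) \<circ> q)"
  proof (rule homotopic_paths_continuous_image[OF assms(1)])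
    show "continuous_on config_space (\<lambda>c k. c (end_pos w k))"
      by (intro continuous_on_coordinatewise_then_product
          continuous_on_subset[OF continuous_on_product_coordinates]) auto
    show "(\<lambda>c k. c (end_pos w k)) \<in> config_space \<rightarrow> config_space"
    proof
      fix c :: "nat \<Rightarrow> complex" assume c: "c \<in> config_space"
      show "(\<lambda>k. c (end_pos w k)) \<in> config_space"
      proof (rule config_spaceI)
        fix j k :: nat assume "1 \<le> j" "1 \<le> k" "j < k"
        then show "c (end_pos w j) \<noteq> c (end_pos w k)"
          using inj_end_pos[of w] by (intro config_spaceD(2) c end_pos_ge_1 assms) (auto simp: inj_def)
      qed (intro config_spaceD(1) c end_pos_ge_1 assms)
    qed
  qed
  then show ?thesis by (simp add: o_def)
qed

lemma homotopic_paths_relabel_letter: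
  assumes "homotopic_paths config_space p q" "a \<noteq> 0"
  shows "homotopic_paths config_space (\<lambda>u k. p u (letter_perm a k)) (\<lambda>u k. q u (letter_perm a k))"
  using homotopic_paths_relabel[OF assms(1), of "[a]"] assms(2) by simp

lemma path_strand: "path (strand (\<lambda>u. u) a)"
  using continuous_strand[OF crossing_schedule_id] by (simp add: path_coordinatewise)

lemma pathfinish_strand: "pathfinish (strand (\<lambda>u. u) a) = (\<lambda>k. of_nat (letter_perm a k))"
  by (rule ext) (simp add: pathfinish_def strand_ends[OF crossing_schedule_id])

lemma pathstart_strand: "pathstart (strand (\<lambda>u. u) a) = of_nat"
  by (rule ext) (simp add: pathstart_def strand_ends[OF crossing_schedule_id])

lemma path_image_strand: "a \<noteq> 0 \<Longrightarrow> path_image (strand (\<lambda>u. u) a) \<subseteq> config_space"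
  using strand_in_config_space[OF crossing_schedule_id] by (auto simp: path_image_def)

lemma pathstart_braid_path: "pathstart (braid_path w) = of_nat"
  by (cases w) (auto simp: pathstart_strand, simp add: pathstart_def)

lemma pathfinish_braid_path: "pathfinish (braid_path w) = (\<lambda>k. of_nat (end_pos w k))"
proof (induction w)
  case (Cons a w)
  then show ?case by (auto simp: pathfinish_def fun_eq_iff joinpaths_def)
qed (simp add: pathfinish_def fun_eq_iff)

lemma braid_path_homotopic_refl: "0 \<notin> set w \<Longrightarrow> homotopic_paths config_space (braid_path w) (braid_path w)"
proof (induction w)
  case Nil
  then show ?case by (auto simp: path_def path_image_def of_nat_config)
next
  case (Cons a w)
  then have "homotopic_paths config_space (\<lambda>u k. braid_path w u (letter_perm a k))
      (\<lambda>u k. braid_path w u (letter_perm a k))"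
    by (intro homotopic_paths_relabel_letter) auto
  moreover have "pathstart (\<lambda>u k. braid_path w u (letter_perm a k)) = (\<lambda>k. of_nat (letter_perm a k))"
    using fun_cong[OF pathstart_braid_path[of w]] by (simp add: pathstart_def fun_eq_iff)
  ultimately show ?case
    using Cons.prems path_image_strand[of a]
    by (auto simp: path_join path_image_join path_strand pathfinish_strand)
qed

lemma path_braid_path: "0 \<notin> set w \<Longrightarrow> path (braid_path w)"
  and path_image_braid_path: "0 \<notin> set w \<Longrightarrow> path_image (braid_path w) \<subseteq> config_space"
  using braid_path_homotopic_refl by auto

lemma pathstart_relabel:
  "pathstart (\<lambda>u k. p u (f k)) = (\<lambda>k. pathstart p (f k))"
  "pathfinish (\<lambda>u k. p u (f k)) = (\<lambda>k. pathfinish p (f k))"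
  by (auto simp: pathstart_def pathfinish_def)

lemma braid_path_append:
  assumes "0 \<notin> set v" "0 \<notin> set w"
  shows "homotopic_paths config_space (braid_path (v @ w))
    (braid_path v +++ (\<lambda>u k. braid_path w u (end_pos v k)))"
  using assms(1)
proof (induction v)
  case Nil
  have "homotopic_paths config_space (braid_path w) (braid_path [] +++ braid_path w)"
    by (rule homotopic_paths_reparametrize[where f="\<lambda>t. max 0 (2 * t - 1)"])
       (use assms path_braid_path path_image_braid_path pathstart_braid_path[of w]
         in \<open>auto simp: joinpaths_def pathstart_def intro!: continuous_intros\<close>)
  then show ?case by simp
next
  case (Cons a v)
  let ?v = "\<lambda>u k. braid_path v u (letter_perm a k)"
  let ?w = "\<lambda>u k. braid_path w u (end_pos (a # v) k)"
  have "homotopic_paths config_space (\<lambda>u k. braid_path (v @ w) u (letter_perm a k))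
      (\<lambda>u k. (braid_path v +++ (\<lambda>u k. braid_path w u (end_pos v k))) u (letter_perm a k))"
    using Cons by (intro homotopic_paths_relabel_letter) auto
  also have "(\<lambda>u k. (braid_path v +++ (\<lambda>u k. braid_path w u (end_pos v k))) u (letter_perm a k))
      = ?v +++ ?w"
    by (auto simp: joinpaths_def fun_eq_iff)
  finally have *: "homotopic_paths config_space (\<lambda>u k. braid_path (v @ w) u (letter_perm a k)) (?v +++ ?w)" .
  have v: "path ?v" "path_image ?v \<subseteq> config_space"
    using homotopic_paths_relabel_letter[OF braid_path_homotopic_refl[of v], of a] Cons.prems by auto
  have w: "path ?w" "path_image ?w \<subseteq> config_space"
    using homotopic_paths_relabel[OF braid_path_homotopic_refl[of w], of "a # v"] Cons.prems assms
    by auto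
  have "homotopic_paths config_space (braid_path ((a # v) @ w)) (strand (\<lambda>u. u) a +++ ?v +++ ?w)"
    using homotopic_paths_join[OF _ *, of "strand (\<lambda>u. u) a" "strand (\<lambda>u. u) a"]
      path_strand path_image_strand[of a] Cons.prems
    by (simp add: pathstart_relabel pathstart_braid_path pathfinish_strand)
  also have "homotopic_paths config_space \<dots> ((strand (\<lambda>u. u) a +++ ?v) +++ ?w)"
    by (rule homotopic_paths_assoc)
       (use v w path_strand path_image_strand[of a] Cons.prems in
         \<open>auto simp: pathstart_relabel[where f="\<lambda>k. end_pos v (letter_perm a k)"] pathstart_relabel
            pathstart_braid_path pathfinish_strand pathfinish_braid_path\<close>)
  finally show ?case by simp
qed

text \<open>
  \<open>lev k\<close> is the level of the strand that starts in position \<open>k\<close>; every letter renames the positions.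
\<close>

fun layered :: "(nat \<Rightarrow> real) \<Rightarrow> braid_word \<Rightarrow> bool" where
  "layered lev [] = True"
| "layered lev (a # w) \<longleftrightarrow>
     lev (letter_perm a (over_pos a)) < lev (over_pos a) \<and> layered (\<lambda>k. lev (letter_perm a k)) w"

lemma ordered_by_strand:
  assumes "lev (letter_perm a (over_pos a)) < lev (over_pos a)" and "crossing_schedule \<phi>"
  shows "ordered_by lev (strand \<phi> a)"
  unfolding ordered_by_def
proof (intro ballI allI impI)
  fix u :: real and j k :: nat
  assume u: "u \<in> {0..1}" and *: "Re (strand \<phi> a u j) = Re (strand \<phi> a u k) \<and> lev j < lev k"
  then have "j \<noteq> k" by auto
  then have c: "k = letter_perm a j" "0 < u" "u < 1"
    using strand_crossing[OF assms(2) u _ , of j k a] * by auto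
  then have "k = over_pos a \<or> j = over_pos a" using over_pos_cases[of a j k] \<open>j \<noteq> k\<close> by auto
  then have "k = over_pos a" using assms(1) * c by auto
  then show "Im (strand \<phi> a u j) < Im (strand \<phi> a u k)"
    using c \<open>j \<noteq> k\<close> by (auto simp: strand_def)
qed

lemma ordered_by_braid_path:
  assumes "layered lev w" "inj lev" "0 \<notin> set w"
  shows "ordered_by lev (braid_path w)"
  using assms
proof (induction w arbitrary: lev)
  case Nil
  then show ?case by (auto simp: ordered_by_def)
next
  case (Cons a w)
  let ?lev = "\<lambda>k. lev (letter_perm a k)"
  have "inj ?lev"
    using Cons.prems(2) unfolding inj_def by (metis letter_perm_eq_iff)
  then have w: "ordered_by ?lev (braid_path w)" using Cons by auto
  have a: "ordered_by lev (strand (\<lambda>u. u) a)"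
    using Cons.prems by (intro ordered_by_strand crossing_schedule_id) auto
  show ?case
    unfolding ordered_by_def
  proof (intro ballI allI impI)
    fix u :: real and j k :: nat
    assume u: "u \<in> {0..1}" and jk: "1 \<le> j" "1 \<le> k" and
      *: "Re (braid_path (a # w) u j) = Re (braid_path (a # w) u k) \<and> lev j < lev k"
    show "Im (braid_path (a # w) u j) < Im (braid_path (a # w) u k)"
    proof (cases "u \<le> 1/2")
      case True
      then show ?thesis
        using a[unfolded ordered_by_def, rule_format, of "2 * u" j k] u jk *
        by (auto simp: joinpaths_def)
    next
      case False
      then show ?thesis
        using w[unfolded ordered_by_def, rule_format, of "2 * u - 1" "letter_perm a j" "letter_perm a k"]
          letter_perm_ge_1[of a j] letter_perm_ge_1[of a k] u jk * Cons.prems(3)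
        by (auto simp: joinpaths_def)
    qed
  qed
qed

lemma layered_words_homotopic:
  assumes "layered lev v" "layered lev w" "inj lev" "0 \<notin> set v" "0 \<notin> set w" "end_pos v = end_pos w"
  shows "homotopic_paths config_space (braid_path v) (braid_path w)"
proof (rule homotopic_paths_layered)
  show "ordered_by lev (braid_path v)" "ordered_by lev (braid_path w)"
    using assms ordered_by_braid_path by auto
  show "path (braid_path v)" "path (braid_path w)" using assms path_braid_path by auto
  show "braid_path v u \<in> config_space" "braid_path w u \<in> config_space" if "u \<in> {0..1}" for u
    using that path_image_braid_path[of v] path_image_braid_path[of w] assms
    by (auto simp: path_image_def)
  have start: "braid_path x 0 = of_nat" and finish: "braid_path x 1 = (\<lambda>k. of_nat (end_pos x k))" for x
    using pathstart_braid_path[of x] pathfinish_braid_path[of x]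
    by (simp_all add: pathstart_def pathfinish_def)
  show "braid_path v 0 = braid_path w 0" "braid_path v 1 = braid_path w 1"
    "Im (braid_path v 0 k) = 0" "Im (braid_path v 1 k) = 0" for k
    by (simp_all add: start finish assms)
qed (use assms in auto)

lemma braid_eq_zero_letter: "v \<doteq> w \<Longrightarrow> 0 \<in> set v \<longleftrightarrow> 0 \<in> set w"
  by (induction rule: braid_eq.induct) auto

lemma homotopic_braid_paths_same_end_pos:
  assumes "homotopic_paths config_space (braid_path v) (braid_path w)"
  shows "end_pos v = end_pos w"
  using homotopic_paths_imp_pathfinish[OF assms]
  by (simp add: pathfinish_braid_path fun_eq_iff)

lemma inj_levels: "inj real" "inj (\<lambda>k. - real k)"
  by (auto simp: inj_def)

lemma end_pos_far: "1 \<le> i \<Longrightarrow> i + 2 \<le> j \<Longrightarrow> end_pos [i, j] k = end_pos [j, i] k"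
  by (auto simp: letter_perm_def)

lemma end_pos_braid: "1 \<le> i \<Longrightarrow> end_pos [i, i + 1, i] k = end_pos [i + 1, i, i + 1] k"
  by (auto simp: letter_perm_def nat_add_distrib)

text \<open>
  In the commutation and braid relations for positive letters, a strand that starts further left is above
  one that starts further right, on both sides. In \<open>\<sigma>\<^sub>i \<sigma>\<^sub>i\<^sup>-\<^sup>1 = 1\<close> the strand above stays above.
\<close>

theorem braid_eq_imp_homotopic:
  assumes "v \<doteq> w" "0 \<notin> set v"
  shows "homotopic_paths config_space (braid_path v) (braid_path w)"
  using assms
proof (induction rule: braid_eq.induct)
  case (reflexive w)
  then show ?case by (rule braid_path_homotopic_refl)
next
  case (symmetric v w)
  then show ?case using braid_eq_zero_letter homotopic_paths_sym by blast
next
  case (transitive u v w)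
  then show ?case using braid_eq_zero_letter homotopic_paths_trans by blast
next
  case (Cons v w a)
  then have "homotopic_paths config_space (\<lambda>u k. braid_path v u (letter_perm a k))
      (\<lambda>u k. braid_path w u (letter_perm a k))"
    by (intro homotopic_paths_relabel_letter) auto
  then show ?case
    using homotopic_paths_join[of config_space "strand (\<lambda>u. u) a" "strand (\<lambda>u. u) a"]
      path_strand path_image_strand[of a] Cons.prems
    by (simp add: pathstart_relabel pathstart_braid_path pathfinish_strand)
next
  case (append_right v w u)
  then have IH: "homotopic_paths config_space (braid_path v) (braid_path w)" by simp
  note end_eq = homotopic_braid_paths_same_end_pos[OF IH]
  have w: "0 \<notin> set w" using append_right braid_eq_zero_letter by auto
  let ?u = "\<lambda>t k. braid_path u t (end_pos v k)"
  have u: "homotopic_paths config_space ?u ?u"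
    using append_right by (intro homotopic_paths_relabel braid_path_homotopic_refl) auto
  have "homotopic_paths config_space (braid_path (v @ u)) (braid_path v +++ ?u)"
    using append_right by (intro braid_path_append) auto
  also have "homotopic_paths config_space \<dots> (braid_path w +++ ?u)"
    by (rule homotopic_paths_join[OF IH u])
       (simp add: pathstart_relabel pathstart_braid_path pathfinish_braid_path)
  also have "homotopic_paths config_space \<dots> (braid_path (w @ u))"
    using braid_path_append[of w u] w append_right.prems
    by (simp add: end_eq homotopic_paths_sym)
  finally show ?case .
next
  case (cancel a)
  \<comment> \<open>For a positive letter the strand from the left is above, for a negative one that from the right.\<close>
  define lev :: "nat \<Rightarrow> real" where "lev k = (if a > 0 then - real k else real k)" for k
  show ?case
    by (rule layered_words_homotopic[where lev=lev])
       (use cancel in \<open>auto simp: lev_def inj_def letter_perm_def over_pos_def fun_eq_iff\<close>)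
next
  case (far i j)
  show ?case
    by (rule layered_words_homotopic[where lev="\<lambda>k. - real k"])
       (use far end_pos_far in \<open>auto simp: inj_levels letter_perm_def over_pos_def fun_eq_iff
          simp del: end_pos.simps\<close>)
next
  case (braid i)
  show ?case
    by (rule layered_words_homotopic[where lev="\<lambda>k. - real k"])
       (use braid end_pos_braid in \<open>auto simp: inj_levels letter_perm_def over_pos_def fun_eq_iff
          nat_add_distrib simp del: end_pos.simps\<close>)
qed

lemma braid_motion_homotopic_braid_path:
  assumes "0 \<notin> set w"
  shows "homotopic_paths config_space (\<lambda>u. braid_motion (\<lambda>u. u) w (real (length w) * u)) (braid_path w)"
  using assms
proof (induction w)
  case Nil
  have "(\<lambda>u::real. braid_motion (\<lambda>u. u) [] (real (length ([]::int list)) * u)) = braid_path []"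
    by (simp add: fun_eq_iff)
  then show ?case using braid_path_homotopic_refl[of "[]"] by simp
next
  case (Cons a w)
  let ?n = "real (length w)" and ?s = "strand (\<lambda>u. u) a"
  let ?m = "\<lambda>u k. braid_motion (\<lambda>u. u) w (?n * u) (letter_perm a k)"
  \<comment> \<open>In the joined path the first letter takes half of the time, in the motion only \<open>1 / (n + 1)\<close> of it.\<close>
  define f where "f u = (if w = [] then u / 2 else
      min ((?n + 1) * u / 2) (1 / 2) + max 0 (((?n + 1) * u - 1) / (2 * ?n)))" for u
  have m: "homotopic_paths config_space ?m (\<lambda>u k. braid_path w u (letter_perm a k))"
    using Cons by (intro homotopic_paths_relabel_letter) auto
  have sm: "homotopic_paths config_space (?s +++ ?m) (braid_path (a # w))"
    using homotopic_paths_join[OF _ m, of ?s ?s] path_strand path_image_strand[of a] Cons.prems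
    by (simp add: pathfinish_strand pathstart_relabel)
       (simp add: pathstart_def braid_motion_0[OF crossing_schedule_id])
  have motion: "(\<lambda>u. braid_motion (\<lambda>u. u) (a # w) (real (length (a # w)) * u)) = (\<lambda>u. (?s +++ ?m) (f u))"
    if "w \<noteq> []"
  proof (intro ext)
    fix u k
    have n: "?n > 0" using that by simp
    show "braid_motion (\<lambda>u. u) (a # w) (real (length (a # w)) * u) k = (?s +++ ?m) (f u) k"
    proof (cases "(?n + 1) * u \<le> 1")
      case True
      then have "f u = (?n + 1) * u / 2" using that n by (simp add: f_def divide_nonpos_pos)
      then show ?thesis using True by (simp add: joinpaths_def algebra_simps)
    next
      case False
      then have f: "f u = 1 / 2 + ((?n + 1) * u - 1) / (2 * ?n)" using that n by (simp add: f_def)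
      have "f u > 1/2" using False n by (simp add: f)
      moreover have "?n * (2 * f u - 1) = (?n + 1) * u - 1" using n by (simp add: f field_simps)
      moreover have "real (length (a # w)) = ?n + 1" by simp
      ultimately show ?thesis
        using False unfolding joinpaths_def braid_motion.simps by (simp only: not_le[symmetric] if_False not_False_eq_True)
    qed
  qed
  have ph: "path (?s +++ ?m)" "path_image (?s +++ ?m) \<subseteq> config_space"
    using homotopic_paths_imp_path[OF sm] homotopic_paths_imp_subset[OF sm] by auto
  show ?case
  proof (cases "w = []")
    case True
    have "homotopic_paths config_space ?s (?s +++ ?m)"
      by (rule homotopic_paths_reparametrize[where f="\<lambda>t. min 1 (2 * t)"])
         (use path_strand path_image_strand[of a] Cons.prems True in
           \<open>auto simp: joinpaths_def strand_ends[OF crossing_schedule_id] fun_eq_iff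
              intro!: continuous_intros\<close>)
    moreover have "homotopic_paths config_space
        (\<lambda>u. braid_motion (\<lambda>u. u) (a # w) (real (length (a # w)) * u)) ?s"
      by (rule homotopic_paths_sym, rule homotopic_paths_eq)
         (use path_strand path_image_strand[of a] Cons.prems True in auto)
    ultimately show ?thesis using sm homotopic_paths_trans by blast
  next
    case False
    then have n: "?n > 0" by simp
    have "homotopic_paths config_space (?s +++ ?m)
        (\<lambda>u. braid_motion (\<lambda>u. u) (a # w) (real (length (a # w)) * u))"
    proof (rule homotopic_paths_reparametrize[OF ph, where f=f])
      show "continuous_on {0..1} f"
        unfolding f_def using n by (auto intro!: continuous_intros)
      show "f 0 = 0" "f 1 = 1" using n False by (auto simp: f_def min_def divide_simps)
      show "f \<in> {0..1} \<rightarrow> {0..1}"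
      proof
        fix u :: real assume u: "u \<in> {0..1}"
        have "(?n + 1) * u \<le> ?n + 1" using u n by (simp add: mult_left_le)
        then have "(?n + 1) * u - 1 \<le> 1 / 2 * (2 * ?n)" by linarith
        then have "((?n + 1) * u - 1) / (2 * ?n) \<le> 1 / 2"
          using n by (simp only: pos_divide_le_eq mult_pos_pos zero_less_numeral)
        then have "max 0 (((?n + 1) * u - 1) / (2 * ?n)) \<le> 1 / 2"
          by (intro max.boundedI) (assumption | simp)+
        then have "max 0 (((?n + 1) * u - 1) / (2 * ?n)) \<in> {0..1/2}"
          unfolding atLeastAtMost_iff by (intro conjI max.cobounded1)
        moreover have "min ((?n + 1) * u / 2) (1 / 2) \<in> {0..1/2}" using u by simp
        moreover have "f u = min ((?n + 1) * u / 2) (1 / 2) + max 0 (((?n + 1) * u - 1) / (2 * ?n))"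
          using False by (simp only: f_def if_False)
        ultimately show "f u \<in> {0..1}" unfolding atLeastAtMost_iff by linarith
      qed
    qed (use motion[OF False] in \<open>simp add: fun_eq_iff\<close>)
    then show ?thesis using sm homotopic_paths_trans homotopic_paths_sym by blast
  qed
qed

lemma braid_motion_affine:
  "(1 - t) *\<^sub>R braid_motion \<phi> w y k + t *\<^sub>R braid_motion \<psi> w y k
    = braid_motion (\<lambda>u. (1 - t) * \<phi> u + t * \<psi> u) w y k"
  by (induction w arbitrary: y k) (auto simp: strand_def complex_eq_iff algebra_simps)

lemma crossing_schedule_convex:
  assumes "crossing_schedule \<phi>" "crossing_schedule \<psi>" "t \<in> {0..1}"
  shows "crossing_schedule (\<lambda>u. (1 - t) * \<phi> u + t * \<psi> u)"
  unfolding crossing_schedule_def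
proof (intro conjI ballI)
  fix u :: real assume "u \<in> {0..1}"
  then show "(1 - t) * \<phi> u + t * \<psi> u \<in> {0..1}"
    using assms convexD[of "{0..1::real}" "\<phi> u" "\<psi> u" "1 - t" t] by (auto simp: crossing_schedule_def)
qed (use assms in \<open>auto simp: crossing_schedule_def intro!: continuous_intros\<close>)

text \<open>
  Schedules form a convex set, and a motion depends on its schedule affinely.
\<close>

lemma braid_motion_schedules_homotopic:
  assumes \<phi>: "crossing_schedule \<phi>" and \<psi>: "crossing_schedule \<psi>" and w: "0 \<notin> set w"
  shows "homotopic_paths config_space (\<lambda>u. braid_motion \<phi> w (real (length w) * u))
    (\<lambda>u. braid_motion \<psi> w (real (length w) * u))"
proof (rule homotopic_paths_straight)
  have cont: "path (\<lambda>u. braid_motion \<phi> w (real (length w) * u))" if "crossing_schedule \<phi>" for \<phi>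
    unfolding path_coordinatewise
    by (intro allI continuous_on_compose2[OF continuous_braid_motion[OF that, of UNIV]]
        continuous_intros) auto
  show "path (\<lambda>u. braid_motion \<phi> w (real (length w) * u))"
    "path (\<lambda>u. braid_motion \<psi> w (real (length w) * u))" using cont \<phi> \<psi> by auto
  fix t u :: real assume t: "t \<in> {0..1}" and u: "u \<in> {0..1}"
  show "(\<lambda>k. (1 - t) *\<^sub>R braid_motion \<phi> w (real (length w) * u) k
            + t *\<^sub>R braid_motion \<psi> w (real (length w) * u) k) \<in> config_space"
    unfolding braid_motion_affine
    using braid_motion_in_config_space[OF crossing_schedule_convex[OF \<phi> \<psi> t] w, of "real (length w) * u"] u
    by (simp add: mult_left_le)
qed (auto simp: fun_eq_iff braid_motion_0 braid_motion_length \<phi> \<psi>)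

lemma braid_eq_same_end_pos:
  assumes "v \<doteq> w" "0 \<notin> set v" shows "end_pos v = end_pos w"
  using braid_eq_imp_homotopic[OF assms] by (rule homotopic_braid_paths_same_end_pos)

lemma braid_eq_motions_homotopic:
  assumes "v \<doteq> w" "0 \<notin> set v" "crossing_schedule \<phi>"
  shows "homotopic_paths config_space (\<lambda>u. braid_motion (\<lambda>u. u) v (real (length v) * u))
    (\<lambda>u. braid_motion \<phi> w (real (length w) * u))"
proof -
  have w: "0 \<notin> set w" using braid_eq_zero_letter assms by auto
  note braid_motion_homotopic_braid_path[OF assms(2)]
  also note braid_eq_imp_homotopic[OF assms(1,2)]
  also note homotopic_paths_sym[OF braid_motion_homotopic_braid_path[OF w]]
  also note braid_motion_schedules_homotopic[OF crossing_schedule_id assms(3) w]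
  finally show ?thesis .
qed

section \<open>From homotopies of motions to ambient isotopies\<close>

lemma ambient_isotopic_refl: "ambient_isotopic K K"
  unfolding ambient_isotopic_def
  by (rule exI[of _ snd])
     (auto intro!: continuous_intros exI[of _ id] simp: homeomorphism_def)

lemma ambient_isotopic_trans:
  fixes K :: "'a::topological_space set"
  assumes "ambient_isotopic K L" "ambient_isotopic L M" shows "ambient_isotopic K M"
proof -
  obtain F :: "real \<times> 'a \<Rightarrow> 'a" where F: "continuous_on ({0..1} \<times> UNIV) F"
    "\<forall>t\<in>{0..1}. \<exists>g. homeomorphism UNIV UNIV (\<lambda>x. F (t, x)) g"
    "\<forall>x. F (0, x) = x" "(\<lambda>x. F (1, x)) ` K = L"
    using assms(1) unfolding ambient_isotopic_def by blast
  obtain G :: "real \<times> 'a \<Rightarrow> 'a" where G: "continuous_on ({0..1} \<times> UNIV) G"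
    "\<forall>t\<in>{0..1}. \<exists>g. homeomorphism UNIV UNIV (\<lambda>x. G (t, x)) g"
    "\<forall>x. G (0, x) = x" "(\<lambda>x. G (1, x)) ` L = M"
    using assms(2) unfolding ambient_isotopic_def by blast
  define H where "H z = (if fst z \<le> 1/2 then F (2 * fst z, snd z)
      else G (2 * fst z - 1, F (1, snd z)))" for z
  have F1: "continuous_on UNIV (\<lambda>x. F (1, x))"
    by (rule continuous_on_compose2[OF F(1)]) (auto intro!: continuous_intros)
  show ?thesis
    unfolding ambient_isotopic_def
  proof (intro exI[of _ H] conjI ballI allI)
    show "continuous_on ({0..1} \<times> UNIV) H"
      unfolding H_def
    proof (rule continuous_on_cases_le)
      show "continuous_on {z \<in> {0..1} \<times> UNIV. fst z \<le> 1 / 2} (\<lambda>z. F (2 * fst z, snd z))"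
        by (rule continuous_on_compose2[OF F(1)]) (auto intro!: continuous_intros)
      show "continuous_on {z \<in> {0..1} \<times> UNIV. 1 / 2 \<le> fst z} (\<lambda>z. G (2 * fst z - 1, F (1, snd z)))"
        by (rule continuous_on_compose2[OF G(1)])
           (auto intro!: continuous_intros continuous_on_compose2[OF F1])
      fix z :: "real \<times> 'a" assume "fst z = 1 / 2"
      then have "2 * fst z = 1" by simp
      then show "F (2 * fst z, snd z) = G (2 * fst z - 1, F (1, snd z))"
        using G(3) by simp
    qed (auto intro!: continuous_intros)
    show "H (0, x) = x" for x using F by (simp add: H_def)
    show "(\<lambda>x. H (1, x)) ` K = M"
      using F(4) G(4) by (simp add: H_def image_image flip: F(4))
    fix t :: real assume t: "t \<in> {0..1}"
    show "\<exists>g. homeomorphism UNIV UNIV (\<lambda>x. H (t, x)) g"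
    proof (cases "t \<le> 1/2")
      case True
      then show ?thesis using t F(2)[rule_format, of "2 * t"] by (simp add: H_def)
    next
      case False
      obtain g1 g2 where "homeomorphism UNIV UNIV (\<lambda>x. F (1, x)) g1"
        "homeomorphism UNIV UNIV (\<lambda>x. G (2 * t - 1, x)) g2"
        using t False F(2)[rule_format, of 1] G(2)[rule_format, of "2 * t - 1"] by auto
      from homeomorphism_compose[OF this] False show ?thesis by (auto simp: H_def o_def)
    qed
  qed
qed

lemma point3_components [simp]:
  "point3 x y z $ 1 = x" "point3 x y z $ 2 = y" "point3 x y z $ 3 = z"
  by (simp_all add: vector_3)

lemma point3_eqI: "v $ 1 = x \<Longrightarrow> v $ 2 = y \<Longrightarrow> v $ 3 = z \<Longrightarrow> v = point3 x y z"
  by (simp add: vec_eq_iff forall_3)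

lemma continuous_on_point3 [continuous_intros]:
  assumes "continuous_on S f" "continuous_on S g" "continuous_on S h"
  shows "continuous_on S (\<lambda>x. point3 (f x) (g x) (h x))"
proof -
  have "point3 a b c = a *\<^sub>R axis 1 1 + b *\<^sub>R axis 2 1 + c *\<^sub>R axis 3 1" for a b c
    by (rule point3_eqI[symmetric]) (simp_all add: axis_def)
  then show ?thesis using assms by (auto intro!: continuous_intros)
qed

text \<open>
  A motion on the time interval from 0 to 1 is drawn on the heights from 0 to \<open>h\<close>.
\<close>

definition closed_braid :: "nat \<Rightarrow> real \<Rightarrow> (real \<Rightarrow> nat \<Rightarrow> complex) \<Rightarrow> (real^3) set" where
  "closed_braid q h p =
     (\<Union>k\<in>{1..q}. (\<lambda>u. point3 (Re (p u k)) (h * u) (Im (p u k))) ` {0..1}) \<union>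
     (\<Union>x\<in>{1..q}. closing_arc h (real x))"

lemma closed_segment_components:
  fixes v :: "real^3"
  assumes "v \<in> closed_segment a b"
  obtains u where "0 \<le> u" "u \<le> 1" "\<And>i. v $ i = (1 - u) * a $ i + u * b $ i"
  using assms by (auto simp: in_segment)

lemma closing_arc_position:
  assumes "v \<in> closing_arc h x" "0 < x" "0 \<le> h"
  shows "v $ 2 \<le> 0 \<or> h \<le> v $ 2 \<or> v $ 1 \<le> 0"
proof -
  have *: "v $ 2 \<le> 0 \<or> h \<le> v $ 2 \<or> v $ 1 \<le> 0"
    if "v \<in> closed_segment a b"
      and "a $ 2 \<le> 0 \<and> b $ 2 \<le> 0 \<or> h \<le> a $ 2 \<and> h \<le> b $ 2 \<or> a $ 1 \<le> 0 \<and> b $ 1 \<le> 0" for a b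
    using that(1)
  proof (rule closed_segment_components)
    fix u assume u: "0 \<le> u" "u \<le> 1" "\<And>i. v $ i = (1 - u) * a $ i + u * b $ i"
    have "(1 - u) * a $ 2 + u * b $ 2 \<ge> (1 - u) * h + u * h" if "h \<le> a $ 2" "h \<le> b $ 2"
      using u that by (intro add_mono mult_left_mono) auto
    moreover have "(1 - u) * a $ i + u * b $ i \<le> (1 - u) * 0 + u * 0" if "a $ i \<le> 0" "b $ i \<le> 0" for i
      using u that by (intro add_mono mult_left_mono) auto
    ultimately show ?thesis using that(2) by (auto simp: u(3) algebra_simps)
  qed
  show ?thesis
    using assms unfolding closing_arc_def polyline.simps Un_iff singleton_iff
    by (elim disjE) ((rule *, assumption, simp) | simp)+
qed

text \<open>
  The solution is the fixed point of the contraction \<open>c \<mapsto> w - t D(c)\<close>.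
\<close>

lemma perturbation_bijective:
  fixes D :: "complex \<Rightarrow> complex"
  assumes "\<And>c c'. dist (D c) (D c') \<le> dist c c' / 2" and t: "t \<in> {0..1}"
  shows "\<exists>!c. c + t *\<^sub>R D c = w"
proof -
  have "\<exists>!c. w - t *\<^sub>R D c = c"
  proof (rule banach_fix_type[of "1/2"])
    show "\<forall>c c'. dist (w - t *\<^sub>R D c) (w - t *\<^sub>R D c') \<le> 1/2 * dist c c'"
    proof (intro allI)
      fix c c'
      have "dist (w - t *\<^sub>R D c) (w - t *\<^sub>R D c') = t * dist (D c) (D c')"
        using t by (simp add: dist_norm norm_minus_commute flip: scaleR_diff_right)
      also have "\<dots> \<le> 1 * dist (D c) (D c')" using t by (intro mult_right_mono) auto
      finally show "dist (w - t *\<^sub>R D c) (w - t *\<^sub>R D c') \<le> 1/2 * dist c c'"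
        using assms(1)[of c c'] by simp
    qed
  qed auto
  then show ?thesis by (simp add: algebra_simps eq_commute)
qed

text \<open>
  Points that stay at distance \<open>e\<close> from each other can be moved by up to \<open>e / (2 q)\<close> with their
  surroundings: displace each horizontal plane by a sum of bumps of radius \<open>e\<close> around the points of \<open>f\<close>.
  This displacement has Lipschitz constant at most \<open>1 / 2\<close>, so the identity plus any
  multiple of it with factor in \<open>[0, 1]\<close> is bijective, and invariance of domain makes the inverse
  continuous. The bumps do not reach the closing arcs.
\<close>

lemma closed_braid_small_move:
  fixes f g :: "real \<Rightarrow> nat \<Rightarrow> complex"
  assumes h: "0 < h" and e: "0 < e"
    and cont: "\<And>k. k \<in> {1..q} \<Longrightarrow> continuous_on UNIV (\<lambda>u. f u k)"
      "\<And>k. k \<in> {1..q} \<Longrightarrow> continuous_on UNIV (\<lambda>u. g u k)"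
    and ends: "\<And>u k. k \<in> {1..q} \<Longrightarrow> u \<le> 0 \<or> 1 \<le> u \<Longrightarrow> f u k = g u k"
    and sep: "\<And>u j k. j \<in> {1..q} \<Longrightarrow> k \<in> {1..q} \<Longrightarrow> j \<noteq> k \<Longrightarrow> e \<le> dist (f u j) (f u k)"
    and right: "\<And>u k. k \<in> {1..q} \<Longrightarrow> e \<le> Re (f u k)"
    and small: "\<And>u k. k \<in> {1..q} \<Longrightarrow> dist (f u k) (g u k) \<le> d" "real q * d \<le> e / 2"
  shows "ambient_isotopic (closed_braid q h f) (closed_braid q h g)"
proof -
  define bump where "bump z = max 0 (1 - norm z / e)" for z :: complex
  define D where "D y c = (\<Sum>k\<in>{1..q}. bump (c - f (y / h) k) *\<^sub>R (g (y / h) k - f (y / h) k))" for y c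
  define H where "H x = snd x + fst x *\<^sub>R
      point3 (Re (D (snd x $ 2) (Complex (snd x $ 1) (snd x $ 3)))) 0
             (Im (D (snd x $ 2) (Complex (snd x $ 1) (snd x $ 3))))" for x :: "real \<times> (real^3)"
  have d: "0 \<le> d" if "k \<in> {1..q}" for k using small(1)[OF that, of 0] zero_le_dist order_trans by blast
  have bump_lip: "\<bar>bump z - bump z'\<bar> \<le> dist z z' / e" for z z'
  proof -
    have "\<bar>norm z / e - norm z' / e\<bar> = \<bar>norm z - norm z'\<bar> / e"
      using e by (simp add: abs_divide flip: diff_divide_distrib)
    also have "\<dots> \<le> dist z z' / e"
      using e norm_triangle_ineq3[of z z'] by (simp add: dist_norm divide_right_mono)
    finally show ?thesis unfolding bump_def by linarith
  qed
  have D_lip: "dist (D y c) (D y c') \<le> dist c c' / 2" for y c c'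
  proof -
    have "dist (D y c) (D y c')
        = norm (\<Sum>k\<in>{1..q}. (bump (c - f (y / h) k) - bump (c' - f (y / h) k)) *\<^sub>R (g (y / h) k - f (y / h) k))"
      by (simp add: D_def dist_norm scaleR_diff_left flip: sum_subtractf)
    also have "\<dots> \<le> (\<Sum>k\<in>{1..q}. dist c c' / e * d)"
    proof (rule sum_norm_le)
      fix k assume k: "k \<in> {1..q}"
      show "norm ((bump (c - f (y / h) k) - bump (c' - f (y / h) k)) *\<^sub>R (g (y / h) k - f (y / h) k))
          \<le> dist c c' / e * d"
        unfolding norm_scaleR using bump_lip[of "c - f (y / h) k" "c' - f (y / h) k"] e
          small(1)[OF k, of "y / h"]
        by (intro mult_mono) (auto simp: dist_norm norm_minus_commute)
    qed
    also have "\<dots> = dist c c' * (real q * d) / e" by simp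
    also have "\<dots> \<le> dist c c' * (e / 2) / e"
      using small(2) e by (intro divide_right_mono mult_left_mono) auto
    finally show ?thesis using e by simp
  qed
  have H_comp: "H (t, v) $ 1 = v $ 1 + t * Re (D (v $ 2) (Complex (v $ 1) (v $ 3)))"
    "H (t, v) $ 2 = v $ 2" "H (t, v) $ 3 = v $ 3 + t * Im (D (v $ 2) (Complex (v $ 1) (v $ 3)))" for t v
    by (simp_all add: H_def)
  have H_fix: "H (t, v) = v" if "D (v $ 2) (Complex (v $ 1) (v $ 3)) = 0" for t v
    by (simp add: vec_eq_iff forall_3 H_comp that)
  have cont_H: "continuous_on S H" for S
  proof -
    have *: "continuous_on S (\<lambda>x. f (snd x $ 2 / h) k)" "continuous_on S (\<lambda>x. g (snd x $ 2 / h) k)"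
      if "k \<in> {1..q}" for k and S :: "(real \<times> (real^3)) set"
      by (rule continuous_on_compose2[OF cont(1)[OF that]] continuous_on_compose2[OF cont(2)[OF that]];
          use h in \<open>auto intro!: continuous_intros\<close>)+
    have "continuous_on S (\<lambda>x. D (snd x $ 2) (Complex (snd x $ 1) (snd x $ 3)))"
      unfolding D_def bump_def using e by (intro continuous_intros continuous_on_Complex *) auto
    then show ?thesis unfolding H_def by (intro continuous_intros) auto
  qed
  have bij: "\<exists>g. homeomorphism UNIV UNIV (\<lambda>x. H (t, x)) g" if t: "t \<in> {0..1}" for t
  proof -
    note unique = perturbation_bijective[OF D_lip t]
    have "inj (\<lambda>x. H (t, x))"
    proof (rule injI)
      fix v w assume "H (t, v) = H (t, w)"
      then have y: "v $ 2 = w $ 2" and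
        "Complex (v $ 1) (v $ 3) + t *\<^sub>R D (v $ 2) (Complex (v $ 1) (v $ 3))
         = Complex (w $ 1) (w $ 3) + t *\<^sub>R D (v $ 2) (Complex (w $ 1) (w $ 3))"
        by (auto simp: vec_eq_iff forall_3 H_comp complex_eq_iff)
      then have "Complex (v $ 1) (v $ 3) = Complex (w $ 1) (w $ 3)" using unique by metis
      with y show "v = w" by (simp add: vec_eq_iff forall_3)
    qed
    moreover have "surj (\<lambda>x. H (t, x))"
      unfolding surj_def
    proof
      fix w :: "real^3"
      obtain c where c: "c + t *\<^sub>R D (w $ 2) c = Complex (w $ 1) (w $ 3)" using unique by metis
      then have "Re c + t * Re (D (w $ 2) c) = w $ 1" "Im c + t * Im (D (w $ 2) c) = w $ 3"
        by (auto simp: complex_eq_iff)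
      then have "H (t, point3 (Re c) (w $ 2) (Im c)) = w"
        by (simp add: vec_eq_iff forall_3 H_comp)
      then show "\<exists>x. w = H (t, x)" by metis
    qed
    moreover have "continuous_on UNIV (\<lambda>x. H (t, x))"
      by (rule continuous_on_compose2[OF cont_H[of UNIV]]) (auto intro!: continuous_intros)
    ultimately show ?thesis
      using invariance_of_domain_homeomorphism[of UNIV "\<lambda>x. H (t, x)"] by auto
  qed
  have D_strand: "D (h * u) (f u k) = g u k - f u k" if k: "k \<in> {1..q}" for u k
  proof -
    have "bump (f u k - f u j) = (if j = k then 1 else 0)" if "j \<in> {1..q}" for j
      using sep[of k j u] k that e by (auto simp: bump_def dist_norm pos_le_divide_eq)
    then have "D (h * u) (f u k) = (\<Sum>j\<in>{1..q}. (if j = k then 1 else 0) *\<^sub>R (g u j - f u j))"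
      unfolding D_def using h by (intro sum.cong) auto
    also have "\<dots> = (\<Sum>j\<in>{1..q}. if j = k then g u j - f u j else 0)"
      by (intro sum.cong) auto
    finally show ?thesis using k by simp
  qed
  have strand: "H (1, point3 (Re (f u k)) (h * u) (Im (f u k))) = point3 (Re (g u k)) (h * u) (Im (g u k))"
    if "k \<in> {1..q}" for u k
    using D_strand[OF that] by (simp add: vec_eq_iff forall_3 H_comp)
  have D_left: "D y c = 0" if "y \<le> 0 \<or> h \<le> y \<or> Re c \<le> 0" for y c
    unfolding D_def
  proof (rule sum.neutral, rule ballI)
    fix k assume k: "k \<in> {1..q}"
    show "bump (c - f (y / h) k) *\<^sub>R (g (y / h) k - f (y / h) k) = 0"
    proof (cases "Re c \<le> 0")
      case True
      have "e \<le> norm (c - f (y / h) k)"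
        using right[OF k, of "y / h"] True abs_Re_le_cmod[of "c - f (y / h) k"] by simp
      then show ?thesis using e by (simp add: bump_def pos_le_divide_eq)
    next
      case False
      then show ?thesis using that ends[OF k, of "y / h"] h by (auto simp: divide_simps)
    qed
  qed
  have arc: "H (1, v) = v" if "x \<in> {1..q}" "v \<in> closing_arc h (real x)" for v x
    using closing_arc_position[OF that(2)] that(1) h by (intro H_fix D_left) auto
  have "(\<lambda>x. H (1, x)) ` closed_braid q h f = closed_braid q h g"
    unfolding closed_braid_def image_Un image_UN image_image using strand arc
    by (intro arg_cong2[where f="(\<union>)"] SUP_cong image_cong refl) auto
  then show ?thesis
    unfolding ambient_isotopic_def
    using cont_H bij by (intro exI[of _ H]) (auto simp: H_def)
qed

lemma closed_braid_cong:
  assumes "\<And>u k. u \<in> {0..1} \<Longrightarrow> k \<in> {1..q} \<Longrightarrow> f u k = g u k"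
  shows "closed_braid q h f = closed_braid q h g"
  unfolding closed_braid_def using assms
  by (intro arg_cong2[where f="(\<union>)"] SUP_cong image_cong refl) auto

lemma finite_common_bound:
  fixes P :: "'a \<Rightarrow> real \<Rightarrow> bool"
  assumes "finite A" "\<And>a. a \<in> A \<Longrightarrow> \<exists>e>0. P a e"
    and mono: "\<And>a e e'. P a e \<Longrightarrow> 0 < e' \<Longrightarrow> e' \<le> e \<Longrightarrow> P a e'"
  shows "\<exists>e>0. \<forall>a\<in>A. P a e"
  using assms(1,2)
proof (induction A rule: finite_induct)
  case empty
  show ?case by (intro exI[of _ 1]) auto
next
  case (insert a A)
  then obtain d e where "0 < d" "P a d" "0 < e" "\<forall>b\<in>A. P b e" by (metis insertCI)
  then show ?case
    by (intro exI[of _ "min d e"]) (auto intro: mono[of a d] mono[of _ e])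
qed

text \<open>
  By compactness, the strands keep a common distance \<open>e\<close> from each other and from the half-plane \<open>x \<le> 0\<close>
  during the whole homotopy, and by uniform continuity it can be cut into finitely many small moves.
\<close>

theorem homotopic_motions_ambient_isotopic:
  assumes "homotopic_paths config_space p q" and h: "0 < h"
  shows "ambient_isotopic (closed_braid n h p) (closed_braid n h q)"
proof -
  from assms(1) obtain H where H: "continuous_on ({0..1::real} \<times> {0..1::real}) H"
      "H \<in> ({0..1} \<times> {0..1}) \<rightarrow> config_space"
      "\<forall>x\<in>{0..1}. H (0, x) = p x" "\<forall>x\<in>{0..1}. H (1, x) = q x"
      "\<forall>t\<in>{0..1}. pathstart (H \<circ> Pair t) = pathstart p \<and> pathfinish (H \<circ> Pair t) = pathfinish p"
    unfolding homotopic_paths by blast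
  let ?K = "{0..1::real} \<times> {0..1::real}"
  have compact: "compact ?K" by (intro compact_Times compact_Icc)
  have cont: "continuous_on ?K (\<lambda>x. H x k)" for k
    by (rule continuous_on_product_then_coordinatewise[OF H(1)])
  have low: "\<exists>e>0. \<forall>x\<in>?K. e \<le> m x" if "continuous_on ?K m" "\<And>x. x \<in> ?K \<Longrightarrow> 0 < m x" for m :: "_ \<Rightarrow> real"
    using continuous_attains_inf[OF compact _ that(1)] that(2) by fastforce
  \<comment> \<open>A diagonal index pair stands for the distance of one point from the imaginary axis.\<close>
  define m where "m jk x = (if fst jk = snd jk then Re (H x (fst jk)) else dist (H x (fst jk)) (H x (snd jk)))"
    for jk :: "nat \<times> nat" and x
  have "\<exists>e>0. \<forall>jk \<in> {1..n} \<times> {1..n}. \<forall>x\<in>?K. e \<le> m jk x"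
  proof (rule finite_common_bound)
    fix jk :: "nat \<times> nat" assume jk: "jk \<in> {1..n} \<times> {1..n}"
    show "\<exists>e>0. \<forall>x\<in>?K. e \<le> m jk x"
    proof (rule low)
      show "continuous_on ?K (m jk)"
        unfolding m_def by (cases "fst jk = snd jk") (auto intro!: continuous_intros cont)
      show "0 < m jk x" if "x \<in> ?K" for x
      proof -
        have "H x \<in> config_space" using H(2) that by blast
        from config_spaceD[OF this, of "fst jk"] show ?thesis using jk by (force simp: m_def)
      qed
    qed
  qed (auto intro: order_trans)
  then obtain e where e: "0 < e" "\<And>jk x. jk \<in> {1..n} \<times> {1..n} \<Longrightarrow> x \<in> ?K \<Longrightarrow> e \<le> m jk x" by blast
  define d where "d = e / (2 * (real n + 1))"
  have d: "0 < d" "real n * d \<le> e / 2" using e(1) by (auto simp: d_def field_simps)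
  have "\<exists>b>0. \<forall>k\<in>{1..n}. \<forall>x\<in>?K. \<forall>y\<in>?K. dist y x < b \<longrightarrow> dist (H y k) (H x k) < d"
  proof (rule finite_common_bound)
    fix k
    show "\<exists>b>0. \<forall>x\<in>?K. \<forall>y\<in>?K. dist y x < b \<longrightarrow> dist (H y k) (H x k) < d"
      using compact_uniformly_continuous[OF cont compact, of k] d(1)
      unfolding uniformly_continuous_on_def by blast
  qed auto
  then obtain b where b: "0 < b" "\<And>k x y. k \<in> {1..n} \<Longrightarrow> x \<in> ?K \<Longrightarrow> y \<in> ?K \<Longrightarrow> dist y x < b \<Longrightarrow>
      dist (H y k) (H x k) < d" by blast
  obtain N where N: "0 < real N" "1 / real N < b"
    using reals_Archimedean[OF b(1)] by (metis inverse_eq_divide of_nat_0_less_iff zero_less_Suc)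
  \<comment> \<open>The homotopy is extended to all times by its constant values at the ends.\<close>
  define clamp where "clamp u = max 0 (min 1 u)" for u :: real
  have clamp: "clamp u \<in> {0..1}" for u by (auto simp: clamp_def)
  define F where "F i u = H (real i / real N, clamp u)" for i :: nat and u
  have step: "ambient_isotopic (closed_braid n h (F i)) (closed_braid n h (F (Suc i)))" if i: "Suc i \<le> N" for i
  proof (rule closed_braid_small_move[OF h e(1)])
    have t: "real i / real N \<in> {0..1}" "real (Suc i) / real N \<in> {0..1}" using i N by auto
    have cont_F: "continuous_on UNIV (\<lambda>u. F j u k)" if "real j / real N \<in> {0..1}" for j k
      unfolding F_def using that
      by (intro continuous_on_compose2[OF cont[of k]]) (auto simp: clamp_def intro!: continuous_intros)
    show "continuous_on UNIV (\<lambda>u. F i u k)" "continuous_on UNIV (\<lambda>u. F (Suc i) u k)" for k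
      using cont_F t by auto
    show "F i u k = F (Suc i) u k" if "u \<le> 0 \<or> 1 \<le> u" for u k
      using H(5) t that unfolding F_def pathstart_def pathfinish_def
      by (auto simp: clamp_def min_def max_def fun_eq_iff)
    show "e \<le> dist (F i u j) (F i u k)" if "j \<in> {1..n}" "k \<in> {1..n}" "j \<noteq> k" for u j k
      using e(2)[of "(j, k)" "(real i / real N, clamp u)"] that t clamp[of u] by (auto simp: m_def F_def)
    show "e \<le> Re (F i u k)" if "k \<in> {1..n}" for u k
      using e(2)[of "(k, k)" "(real i / real N, clamp u)"] that t clamp[of u] by (auto simp: m_def F_def)
    show "dist (F i u k) (F (Suc i) u k) \<le> d" if "k \<in> {1..n}" for u k
    proof -
      have "real i / real N - real (Suc i) / real N = - (1 / real N)"
        by (simp flip: diff_divide_distrib)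
      then have "dist (real i / real N, clamp u) (real (Suc i) / real N, clamp u) < b"
        using N by (simp add: dist_Pair_Pair dist_real_def)
      then show ?thesis
        unfolding F_def using b(2)[OF that] t clamp[of u] by (meson less_imp_le mem_Sigma_iff)
    qed
    show "real n * d \<le> e / 2" by (rule d)
  qed
  have "ambient_isotopic (closed_braid n h (F 0)) (closed_braid n h (F i))" if "i \<le> N" for i
    using that
  proof (induction i)
    case 0
    show ?case by (rule ambient_isotopic_refl)
  next
    case (Suc i)
    then show ?case using step[of i] ambient_isotopic_trans by (meson Suc_leD)
  qed
  from this[of N] have "ambient_isotopic (closed_braid n h (F 0)) (closed_braid n h (F N))" by simp
  moreover have "closed_braid n h (F 0) = closed_braid n h p"
    by (rule closed_braid_cong) (use H(3) in \<open>auto simp: F_def clamp_def\<close>)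
  moreover have "closed_braid n h (F N) = closed_braid n h q"
    by (rule closed_braid_cong) (use H(4) N in \<open>auto simp: F_def clamp_def\<close>)
  ultimately show ?thesis by simp
qed

section \<open>Closed braids of words as closed motions\<close>

lemma point3_eq_iff: "point3 x y z = point3 x' y' z' \<longleftrightarrow> x = x' \<and> y = y' \<and> z = z'"
  by (auto simp: vec_eq_iff forall_3)

definition letter_part :: "(real \<Rightarrow> real) \<Rightarrow> nat \<Rightarrow> real \<Rightarrow> real \<Rightarrow> int \<Rightarrow> (real^3) set" where
  "letter_part \<phi> q c y a =
     (\<Union>k\<in>{1..q}. (\<lambda>u. point3 (Re (strand \<phi> a u k)) (y + c * u) (Im (strand \<phi> a u k))) ` {0..1})"

definition proper_word :: "nat \<Rightarrow> braid_word \<Rightarrow> bool" where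
  "proper_word q w \<longleftrightarrow> (\<forall>a\<in>set w. a \<noteq> 0 \<and> \<bar>a\<bar> < int q)"

lemma letter_perm_range:
  assumes "a \<noteq> 0" "\<bar>a\<bar> < int q" shows "letter_perm a ` {1..q} = {1..q}"
proof -
  have "letter_perm a ` {1..q} \<subseteq> {1..q}"
    using assms by (auto simp: letter_perm_def)
  moreover have "inj_on (letter_perm a) {1..q}" by (simp add: inj_on_def)
  ultimately show ?thesis by (simp add: endo_inj_surj)
qed

lemma end_pos_range:
  "proper_word q w \<Longrightarrow> end_pos w ` {1..q} = {1..q}"
proof (induction w)
  case (Cons a w)
  have "end_pos (a # w) ` {1..q} = end_pos w ` letter_perm a ` {1..q}"
    by (simp add: image_image)
  then show ?case using Cons letter_perm_range[of a q] by (auto simp: proper_word_def)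
qed simp

text \<open>
  The row of end points on the left-hand side makes the formula hold for the empty word, too, where time
  is the single point 0.
\<close>

lemma letter_parts_eq_motion:
  assumes \<phi>: "crossing_schedule \<phi>" and "proper_word q w"
  shows "(\<Union>j<length w. letter_part \<phi> q c (y + c * real j) (w ! j)) \<union>
      (\<lambda>k. point3 (real k) (y + c * real (length w)) 0) ` {1..q}
    = (\<Union>k\<in>{1..q}. (\<lambda>t. point3 (Re (braid_motion \<phi> w t k)) (y + c * t) (Im (braid_motion \<phi> w t k)))
        ` {0..real (length w)})"
  using assms(2)
proof (induction w arbitrary: y)
  case Nil
  then show ?case by auto
next
  case (Cons a w)
  let ?n = "real (length w)"
  let ?M = "\<lambda>w y k t. point3 (Re (braid_motion \<phi> w t k)) (y + c * t) (Im (braid_motion \<phi> w t k))"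
  have a: "a \<noteq> 0" "\<bar>a\<bar> < int q" and w: "proper_word q w"
    using Cons.prems by (auto simp: proper_word_def)
  have split: "{0..real (length (a # w))} = {0..1} \<union> (\<lambda>t. t + 1) ` {0..?n}"
  proof -
    have "t \<in> (\<lambda>t. t + 1) ` {0..?n}" if "1 \<le> t" "t \<le> ?n + 1" for t
      by (rule image_eqI[of _ _ "t - 1"]) (use that in auto)
    then show ?thesis by fastforce
  qed
  have first: "?M (a # w) y k ` {0..1}
      = (\<lambda>u. point3 (Re (strand \<phi> a u k)) (y + c * u) (Im (strand \<phi> a u k))) ` {0..1}" for k
    by (intro image_cong) auto
  have step: "braid_motion \<phi> (a # w) (t + 1) k = braid_motion \<phi> w t (letter_perm a k)" if "0 \<le> t" for t k
    using that by (cases "t = 0") (simp_all add: strand_ends[OF \<phi>] braid_motion_0[OF \<phi>])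
  have rest: "?M (a # w) y k ` (\<lambda>t. t + 1) ` {0..?n} = ?M w (y + c) (letter_perm a k) ` {0..?n}" for k
    unfolding image_image
  proof (intro image_cong refl)
    fix t assume "t \<in> {0..?n}"
    then have "0 \<le> t" by simp
    show "?M (a # w) y k (t + 1) = ?M w (y + c) (letter_perm a k) t"
      unfolding step[OF \<open>0 \<le> t\<close>] point3_eq_iff by (simp add: algebra_simps)
  qed
  have reindex: "(\<Union>k\<in>{1..q}. G (letter_perm a k)) = (\<Union>k\<in>{1..q}. G k)" for G :: "nat \<Rightarrow> (real^3) set"
  proof -
    have "(\<Union>k\<in>letter_perm a ` {1..q}. G k) = (\<Union>k\<in>{1..q}. G (letter_perm a k))"
      unfolding image_image ..
    then show ?thesis by (simp only: letter_perm_range[OF a])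
  qed
  have "(\<Union>k\<in>{1..q}. ?M (a # w) y k ` {0..real (length (a # w))})
      = letter_part \<phi> q c y a \<union> (\<Union>k\<in>{1..q}. ?M w (y + c) (letter_perm a k) ` {0..?n})"
    unfolding split image_Un first rest letter_part_def UN_Un_distrib ..
  also have "(\<Union>k\<in>{1..q}. ?M w (y + c) (letter_perm a k) ` {0..?n})
      = (\<Union>k\<in>{1..q}. ?M w (y + c) k ` {0..?n})"
    by (rule reindex)
  also have "\<dots> = (\<Union>j<length w. letter_part \<phi> q c (y + c + c * real j) (w ! j)) \<union>
      (\<lambda>k. point3 (real k) (y + c + c * ?n) 0) ` {1..q}"
    using Cons.IH[OF w, of "y + c"] by simp
  finally show ?case
    by (simp add: lessThan_Suc_eq_insert_0 image_image Un_assoc algebra_simps)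
qed

lemma closed_motion_eq_letter_parts:
  assumes \<phi>: "crossing_schedule \<phi>" and w: "proper_word q w" "w \<noteq> []" and h: "h = c * real (length w)"
  shows "closed_braid q h (\<lambda>u. braid_motion \<phi> w (real (length w) * u))
    = (\<Union>j<length w. letter_part \<phi> q c (c * real j) (w ! j)) \<union> (\<Union>x\<in>{1..q}. closing_arc h (real x))"
proof -
  let ?n = "real (length w)"
  have n: "0 < ?n" using w by simp
  have "{0..?n} = (\<lambda>u. ?n * u) ` {0..1}" using n by (simp add: image_mult_atLeastAtMost)
  then have strands: "(\<Union>k\<in>{1..q}. (\<lambda>u. point3 (Re (braid_motion \<phi> w (?n * u) k)) (h * u)
        (Im (braid_motion \<phi> w (?n * u) k))) ` {0..1})
      = (\<Union>j<length w. letter_part \<phi> q c (c * real j) (w ! j)) \<union> (\<lambda>k. point3 (real k) h 0) ` {1..q}"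
    using letter_parts_eq_motion[OF \<phi> w(1), of c 0] by (simp add: image_image h mult.assoc)
  have "point3 x h 0 \<in> closing_arc h x" for x
    by (simp add: closing_arc_def)
  then have "(\<lambda>k. point3 (real k) h 0) ` {1..q} \<subseteq> (\<Union>x\<in>{1..q}. closing_arc h (real x))" by blast
  then show ?thesis unfolding closed_braid_def strands by blast
qed

lemma image_two_segments:
  fixes f :: "real \<Rightarrow> 'a::real_vector"
  assumes "\<And>u. u \<in> {0..1} \<Longrightarrow> f (u / 2) = (1 - u) *\<^sub>R a + u *\<^sub>R b"
    and "\<And>u. u \<in> {0..1} \<Longrightarrow> f ((1 + u) / 2) = (1 - u) *\<^sub>R b + u *\<^sub>R d"
  shows "f ` {0..1} = closed_segment a b \<union> closed_segment b d"
proof -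
  have "{0..1::real} = (\<lambda>u. u / 2) ` {0..1} \<union> (\<lambda>u. (1 + u) / 2) ` {0..1}"
  proof -
    have "t \<in> (\<lambda>u. u / 2) ` {0..1} \<or> t \<in> (\<lambda>u. (1 + u) / 2) ` {0..1}" if "t \<in> {0..1}" for t :: real
    proof (cases "t \<le> 1 / 2")
      case True
      then show ?thesis using that by (intro disjI1 image_eqI[of _ _ "2 * t"]) auto
    next
      case False
      then show ?thesis using that by (intro disjI2 image_eqI[of _ _ "2 * t - 1"]) auto
    qed
    then have "{0..1::real} \<subseteq> (\<lambda>u. u / 2) ` {0..1} \<union> (\<lambda>u. (1 + u) / 2) ` {0..1}" by blast
    then show ?thesis by (rule equalityI) auto
  qed
  then have "f ` {0..1} = (\<lambda>u. f (u / 2)) ` {0..1} \<union> (\<lambda>u. f ((1 + u) / 2)) ` {0..1}"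
    by (metis image_Un image_image)
  also have "\<dots> = closed_segment a b \<union> closed_segment b d"
    unfolding closed_segment_image_interval
    by (intro arg_cong2[where f="(\<union>)"] image_cong refl assms)
  finally show ?thesis .
qed

lemma point3_combination:
  "(1 - u) *\<^sub>R point3 x y z + u *\<^sub>R point3 x' y' z'
    = point3 ((1 - u) * x + u * x') ((1 - u) * y + u * y') ((1 - u) * z + u * z')"
  by (rule point3_eqI) simp_all

lemma polyline_three: "polyline [a, b, d] = closed_segment a b \<union> closed_segment b d"
  by auto

lemma letter_strands_eq_letter_part:
  assumes "a \<noteq> 0" "\<bar>a\<bar> < int q"
  shows "letter_strands q y a = letter_part (\<lambda>u. u) q 1 y a"
proof -
  let ?i = "nat \<bar>a\<bar>" and ?o = "over_pos a" and ?u = "letter_perm a (over_pos a)"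
  let ?S = "\<lambda>k. (\<lambda>u. point3 (Re (strand (\<lambda>u. u) a u k)) (y + 1 * u) (Im (strand (\<lambda>u. u) a u k))) ` {0..1}"
  have straight: "?S k = closed_segment (point3 (real k) y 0) (point3 (real (letter_perm a k)) (y + 1) 0)"
    if "k \<noteq> ?o" for k
    unfolding closed_segment_image_interval point3_combination
    using that by (intro image_cong) (auto simp: strand_def algebra_simps)
  have over: "?S ?o = polyline [point3 (real ?o) y 0, point3 (real ?i + 1/2) (y + 1/2) 1, point3 (real ?u) (y + 1) 0]"
  proof -
    have mid: "real ?o + real ?u = 2 * real ?i + 1" by (auto simp: over_pos_def letter_perm_def)
    have "?S ?o = closed_segment (point3 (real ?o) y 0) (point3 (real ?i + 1/2) (y + 1/2) 1)
        \<union> closed_segment (point3 (real ?i + 1/2) (y + 1/2) 1) (point3 (real ?u) (y + 1) 0)"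
    proof (rule image_two_segments)
      fix u :: real assume u: "u \<in> {0..1}"
      have u': "real ?u = 2 * real ?i + 1 - real ?o" using mid by simp
      show "point3 (Re (strand (\<lambda>u. u) a (u / 2) ?o)) (y + 1 * (u / 2)) (Im (strand (\<lambda>u. u) a (u / 2) ?o))
        = (1 - u) *\<^sub>R point3 (real ?o) y 0 + u *\<^sub>R point3 (real ?i + 1/2) (y + 1/2) 1"
        unfolding point3_combination point3_eq_iff using u
        by (simp add: strand_def u' field_simps)
      show "point3 (Re (strand (\<lambda>u. u) a ((1 + u) / 2) ?o)) (y + 1 * ((1 + u) / 2)) (Im (strand (\<lambda>u. u) a ((1 + u) / 2) ?o))
        = (1 - u) *\<^sub>R point3 (real ?i + 1/2) (y + 1/2) 1 + u *\<^sub>R point3 (real ?u) (y + 1) 0"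
        unfolding point3_combination point3_eq_iff using u
        by (simp add: strand_def u' field_simps)
    qed
    then show ?thesis unfolding polyline_three .
  qed
  have "({1..q} - {?i, ?i + 1}) \<union> {?o, ?u} = {1..q}"
    using assms by (auto simp: over_pos_def letter_perm_def)
  then have "letter_part (\<lambda>u. u) q 1 y a = (\<Union>k\<in>({1..q} - {?i, ?i + 1}) \<union> {?o, ?u}. ?S k)"
    unfolding letter_part_def by (rule arg_cong[OF sym])
  also have "\<dots> = (\<Union>k\<in>{1..q} - {?i, ?i + 1}. ?S k) \<union> ?S ?o \<union> ?S ?u"
    by (simp only: UN_Un UN_insert UN_empty Un_empty_right Un_assoc)
  also have "?S ?u = closed_segment (point3 (real ?u) y 0) (point3 (real ?o) (y + 1) 0)"
    using straight[OF letter_perm_over_pos] by simp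
  also have "(\<Union>k\<in>{1..q} - {?i, ?i + 1}. ?S k)
      = (\<Union>k\<in>{1..q} - {?i, ?i + 1}. closed_segment (point3 (real k) y 0) (point3 (real k) (y + 1) 0))"
  proof (intro SUP_cong refl)
    fix k assume "k \<in> {1..q} - {?i, ?i + 1}"
    then have "k \<noteq> ?o" "letter_perm a k = k" by (auto simp: over_pos_def letter_perm_def)
    then show "?S k = closed_segment (point3 (real k) y 0) (point3 (real k) (y + 1) 0)"
      using straight[of k] by simp
  qed
  finally show ?thesis
    unfolding letter_strands_def Let_def over
    by (cases "a > 0") (simp_all add: over_pos_def letter_perm_def add.commute)
qed

lemma braid_closure_eq_closed_motion:
  assumes "proper_word q w" "w \<noteq> []"
  shows "braid_closure q w
    = closed_braid q (real (length w)) (\<lambda>u. braid_motion (\<lambda>u. u) w (real (length w) * u))"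
proof -
  have "letter_strands q (real j) (w ! j) = letter_part (\<lambda>u. u) q 1 (1 * real j) (w ! j)"
    if "j < length w" for j
    using letter_strands_eq_letter_part[of "w ! j" q "real j"] assms(1) that
    by (auto simp: proper_word_def)
  then show ?thesis
    unfolding braid_closure_def
    by (subst closed_motion_eq_letter_parts[OF crossing_schedule_id assms, of _ 1]) auto
qed

section \<open>The polygonal diagram of a closed positive braid\<close>

text \<open>
  With this schedule the over-strand is raised in the first half of a letter and the strands change places
  in the second half. The motion is linear on each half, it has integer horizontal coordinates at the ends
  of the halves, and its crossings are interior to the edges.
\<close>

definition late :: "real \<Rightarrow> real" where "late u = max 0 (2 * u - 1)"

lemma crossing_schedule_late: "crossing_schedule late"
  unfolding crossing_schedule_def late_def by (auto intro!: continuous_intros)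

text \<open>
  The last two assumptions say that the closure has only one component. The height \<open>c\<close> of a letter is free so
  that the diagram can be given the same total height as the closure of a word of another length.
\<close>

locale positive_braid_knot =
  fixes q :: nat and w :: braid_word and c :: real
  assumes c_pos: "0 < c"
    and positive: "positive_word q w"
    and nonempty: "w \<noteq> []"
    and cycle: "bij_betw (\<lambda>s. (end_pos w ^^ s) 1) {..<q} {1..q}"
    and return: "(end_pos w ^^ q) 1 = 1"
begin

text \<open>
  The knot passes \<open>q\<close> times through the braid; \<open>start_pos s\<close> is the position in which it enters for the
  \<open>s\<close>-th time.
\<close>

definition start_pos :: "nat \<Rightarrow> nat" where
  "start_pos s = (end_pos w ^^ s) 1"

definition len :: nat where "len = length w"

definition height :: real where "height = c * real len"

text \<open>
  The position after \<open>m\<close> half letters of the \<open>s\<close>-th passage; it changes only in the second half of a letter.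
\<close>

definition pos :: "nat \<Rightarrow> nat \<Rightarrow> nat" where
  "pos s m = end_pos (take (m div 2) w) (start_pos s)"

definition lift :: "nat \<Rightarrow> nat \<Rightarrow> real" where
  "lift s m = (if odd m \<and> pos s m = over_pos (w ! (m div 2)) then 1 else 0)"

text \<open>
  Passage \<open>s\<close> has vertices with the indices \<open>0, \<dots>, 2 len\<close> in the braid and the four corners
  of its closing arc. The last value is the first vertex of the next passage, so that edges can be
  described without wrapping indices around.
\<close>

definition vert :: "nat \<Rightarrow> nat \<Rightarrow> real^3" where
  "vert s m = (let x = real (start_pos (Suc s)) in
     if m \<le> 2 * len then point3 (real (pos s m)) (c / 2 * real m) (lift s m)
     else if m = 2 * len + 1 then point3 x (height + x) 0
     else if m = 2 * len + 2 then point3 (- x) (height + x) 0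
     else if m = 2 * len + 3 then point3 (- x) (- x) 0
     else if m = 2 * len + 4 then point3 x (- x) 0
     else point3 x 0 0)"

definition strand_edge :: "nat \<Rightarrow> nat \<Rightarrow> (real^3) set" where
  "strand_edge s m = closed_segment (vert s m) (vert s (Suc m))"

lemma letters: "a \<in> set w \<Longrightarrow> 1 \<le> a \<and> a < int q"
  using positive by (auto simp: positive_word_def)

lemma no_zero: "0 \<notin> set w" using letters by force

lemma height_pos: "0 < height"
  using c_pos nonempty by (simp add: height_def len_def)

lemma start_pos_Suc: "start_pos (Suc s) = end_pos w (start_pos s)"
  by (simp add: start_pos_def)

lemma start_pos_ge_1: "1 \<le> start_pos s"
  by (induction s) (simp_all only: start_pos_Suc, simp_all add: start_pos_def end_pos_ge_1[OF no_zero, simplified])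

lemma start_pos_inj: "s < q \<Longrightarrow> s' < q \<Longrightarrow> start_pos s = start_pos s' \<longleftrightarrow> s = s'"
  using cycle by (auto simp: bij_betw_def inj_on_def start_pos_def)

lemma start_pos_Suc_inj: "s < q \<Longrightarrow> s' < q \<Longrightarrow> start_pos (Suc s) = start_pos (Suc s') \<longleftrightarrow> s = s'"
  unfolding start_pos_Suc inj_eq[OF inj_end_pos] by (rule start_pos_inj)

lemma start_pos_image: "start_pos ` {..<q} = {1..q}"
  using cycle by (auto simp: bij_betw_def start_pos_def)

lemma pos_inj: "s < q \<Longrightarrow> s' < q \<Longrightarrow> pos s m = pos s' m \<longleftrightarrow> s = s'"
  unfolding pos_def inj_eq[OF inj_end_pos] by (rule start_pos_inj)

lemma pos_ge_1: "1 \<le> pos s m"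
  unfolding pos_def using no_zero by (intro end_pos_ge_1 start_pos_ge_1) (auto dest: in_set_takeD)

lemma pos_even: "even m \<Longrightarrow> pos s (Suc m) = pos s m"
  by (simp add: pos_def)

lemma pos_odd:
  assumes "odd m" "m < 2 * len"
  shows "pos s (Suc m) = letter_perm (w ! (m div 2)) (pos s m)"
proof -
  have "Suc m div 2 = Suc (m div 2)" using assms by presburger
  moreover have "m div 2 < length w" using assms by (auto simp: len_def)
  ultimately show ?thesis by (simp add: pos_def take_Suc_conv_app_nth end_pos_append)
qed

lemma pos_0: "pos s 0 = start_pos s"
  by (simp add: pos_def)

lemma pos_end: "pos s (2 * len) = start_pos (Suc s)"
  by (simp add: pos_def len_def start_pos_Suc)

lemma vert_strand: "m \<le> 2 * len \<Longrightarrow> vert s m = point3 (real (pos s m)) (c / 2 * real m) (lift s m)"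
  by (simp add: vert_def)

lemma vert_arc:
  "vert s (2 * len) = point3 (real (start_pos (Suc s))) height 0"
  "vert s (2 * len + 1) = point3 (real (start_pos (Suc s))) (height + real (start_pos (Suc s))) 0"
  "vert s (2 * len + 2) = point3 (- real (start_pos (Suc s))) (height + real (start_pos (Suc s))) 0"
  "vert s (2 * len + 3) = point3 (- real (start_pos (Suc s))) (- real (start_pos (Suc s))) 0"
  "vert s (2 * len + 4) = point3 (real (start_pos (Suc s))) (- real (start_pos (Suc s))) 0"
  "vert s (2 * len + 5) = point3 (real (start_pos (Suc s))) 0 0"
  by (simp_all add: vert_def Let_def pos_end lift_def height_def)

lemma strand_edgeE:
  assumes "v \<in> strand_edge s m" "m < 2 * len"
  obtains u where "0 \<le> u" "u \<le> 1" "v $ 1 = (1 - u) * real (pos s m) + u * real (pos s (Suc m))"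
    "v $ 2 = c / 2 * (real m + u)" "v $ 3 = (1 - u) * lift s m + u * lift s (Suc m)"
    "1 \<le> v $ 1" "0 \<le> v $ 2" "v $ 2 \<le> height"
proof -
  from assms obtain u where u: "0 \<le> u" "u \<le> 1" "\<And>i. v $ i = (1 - u) * vert s m $ i + u * vert s (Suc m) $ i"
    unfolding strand_edge_def by (auto elim: closed_segment_components)
  have y: "v $ 2 = c / 2 * (real m + u)" using u(3)[of 2] assms(2) by (simp add: vert_strand field_simps)
  have "(1 - u) * 1 + u * 1 \<le> (1 - u) * real (pos s m) + u * real (pos s (Suc m))"
    using u pos_ge_1[of s m] pos_ge_1[of s "Suc m"] by (intro add_mono mult_left_mono) auto
  moreover have x: "v $ 1 = (1 - u) * real (pos s m) + u * real (pos s (Suc m))"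
    using u(3)[of 1] assms(2) by (simp add: vert_strand)
  moreover have z: "v $ 3 = (1 - u) * lift s m + u * lift s (Suc m)"
    using u(3)[of 3] assms(2) by (simp add: vert_strand)
  moreover have "0 \<le> v $ 2" using u(1) c_pos by (simp add: y)
  moreover have "v $ 2 \<le> height"
  proof -
    have "real m + u \<le> 2 * real len" using u assms(2) by linarith
    then have "c / 2 * (real m + u) \<le> c / 2 * (2 * real len)"
      using c_pos by (intro mult_left_mono) auto
    then show ?thesis by (simp add: y height_def)
  qed
  ultimately show ?thesis using u(1,2) y by (intro that[of u]) auto
qed

lemma arc_edgeE:
  assumes "v \<in> strand_edge s m" "2 * len \<le> m" "m < 2 * len + 5"
  obtains x where "x = real (start_pos (Suc s))" "1 \<le> x" "v $ 3 = 0"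
    "m = 2 * len \<and> v $ 1 = x \<and> height \<le> v $ 2 \<and> v $ 2 \<le> height + x \<or>
     m = 2 * len + 1 \<and> v $ 2 = height + x \<and> - x \<le> v $ 1 \<and> v $ 1 \<le> x \<or>
     m = 2 * len + 2 \<and> v $ 1 = - x \<and> - x \<le> v $ 2 \<and> v $ 2 \<le> height + x \<or>
     m = 2 * len + 3 \<and> v $ 2 = - x \<and> - x \<le> v $ 1 \<and> v $ 1 \<le> x \<or>
     m = 2 * len + 4 \<and> v $ 1 = x \<and> - x \<le> v $ 2 \<and> v $ 2 \<le> 0"
proof -
  define x where "x = real (start_pos (Suc s))"
  have x: "1 \<le> x" using start_pos_ge_1[of "Suc s"] by (simp add: x_def)
  from assms obtain u where u: "0 \<le> u" "u \<le> 1" "\<And>i. v $ i = (1 - u) * vert s m $ i + u * vert s (Suc m) $ i"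
    unfolding strand_edge_def by (auto elim: closed_segment_components)
  have ux: "0 \<le> u * x" "u * x \<le> x" "0 \<le> u * height" "u * height \<le> height"
    using u x height_pos by (auto simp: mult_left_le_one_le)
  consider "m = 2 * len" | "m = 2 * len + 1" | "m = 2 * len + 2" | "m = 2 * len + 3" | "m = 2 * len + 4"
    using assms(2,3) by linarith
  then show ?thesis
  proof cases
    case 1
    then have "vert s m = point3 x height 0" "vert s (Suc m) = point3 x (height + x) 0"
      using vert_arc(1,2)[of s] by (simp_all add: x_def)
    then show ?thesis using 1 ux x by (intro that[of x]) (auto simp: u(3) x_def[symmetric] algebra_simps)
  next
    case 2
    then have "vert s m = point3 x (height + x) 0" "vert s (Suc m) = point3 (- x) (height + x) 0"
      using vert_arc(2,3)[of s] by (simp_all add: x_def)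
    then show ?thesis using 2 ux x by (intro that[of x]) (auto simp: u(3) x_def[symmetric] algebra_simps)
  next
    case 3
    then have "vert s m = point3 (- x) (height + x) 0" "vert s (Suc m) = point3 (- x) (- x) 0"
      using vert_arc(3,4)[of s] by (simp_all add: x_def numeral_3_eq_3)
    then have "v $ 1 = - x" "v $ 2 = height + x - u * height - 2 * (u * x)" "v $ 3 = 0"
      by (simp_all add: u(3) algebra_simps)
    moreover from this ux have "- x \<le> v $ 2" "v $ 2 \<le> height + x" by linarith+
    ultimately show ?thesis using 3 x by (intro that[of x]) (auto simp: x_def[symmetric])
  next
    case 4
    then have "vert s m = point3 (- x) (- x) 0" "vert s (Suc m) = point3 x (- x) 0"
      using vert_arc(4,5)[of s] by (simp_all add: x_def add.commute)
    then show ?thesis using 4 ux x by (intro that[of x]) (auto simp: u(3) x_def[symmetric] algebra_simps)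
  next
    case 5
    then have "vert s m = point3 x (- x) 0" "vert s (Suc m) = point3 x 0 0"
      using vert_arc(5,6)[of s] by (simp_all add: x_def add.commute)
    then show ?thesis using 5 ux x by (intro that[of x]) (auto simp: u(3) x_def[symmetric] algebra_simps)
  qed
qed

lemma vert_in_edge: "vert s m \<in> strand_edge s m" "vert s (Suc m) \<in> strand_edge s m"
  by (auto simp: strand_edge_def)

lemma height_lt_iff: "c / 2 * real m < height \<longleftrightarrow> m < 2 * len"
proof -
  have "height = c / 2 * real (2 * len)" by (simp add: height_def)
  then show ?thesis
    using c_pos by (simp only: mult_less_cancel_left_pos half_gt_zero of_nat_less_iff)
qed

text \<open>
  Inside the braid, vertices and edges of different half letters are separated by their heights and equal
  heights leave only the positions to compare. The closing arcs lie on nested rectangles, so a common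
  point of two of them determines the passage.
\<close>

lemma vertex_on_edge:
  assumes s: "s < q" "s' < q" and m: "m < 2 * len + 5" "m' < 2 * len + 5"
    and v: "v \<in> strand_edge s' m'" "v $ 1 = vert s m $ 1" "v $ 2 = vert s m $ 2"
  shows "s = s' \<and> (m = m' \<or> m = Suc m') \<or>
    m = 0 \<and> m' = 2 * len + 4 \<and> start_pos s = start_pos (Suc s')"
proof -
  note s_eq = start_pos_Suc_inj[OF s]
  consider (strands) "m \<le> 2 * len" "m' < 2 * len" | (arc_strand) "2 * len < m" "m' < 2 * len"
    | (strand_arc) "m < 2 * len" "2 * len \<le> m'" | (arcs) "2 * len \<le> m" "2 * len \<le> m'"
    by linarith
  then show ?thesis
  proof cases
    case strands
    from v(1) strands(2) obtain u where u: "0 \<le> u" "u \<le> 1"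
      "v $ 1 = (1 - u) * real (pos s' m') + u * real (pos s' (Suc m'))" "v $ 2 = c / 2 * (real m' + u)"
      by (rule strand_edgeE)
    have "c / 2 * real m = c / 2 * (real m' + u)"
      unfolding u(4)[symmetric] v(3) vert_strand[OF strands(1)] by simp
    moreover have "c / 2 \<noteq> 0" using c_pos by simp
    ultimately have mu: "real m = real m' + u" using mult_left_cancel[of "c / 2"] by blast
    then consider "m = m'" "u = 0" | "m = Suc m'" "u = 1"
    proof -
      have "real m' \<le> real m" "real m \<le> real (Suc m')" using mu u by auto
      then have "m = m' \<or> m = Suc m'" by linarith
      then show thesis using mu that by auto
    qed
    then have "pos s m = pos s' m" and "m = m' \<or> m = Suc m'"
      using v(2) u(3) strands by (cases; simp add: vert_strand)+
    then show ?thesis using pos_inj[OF s] by auto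
  next
    case arc_strand
    from v(1) arc_strand(2) have "1 \<le> v $ 1" "0 \<le> v $ 2" "v $ 2 \<le> height"
      by (auto elim: strand_edgeE)
    moreover have "height < vert s m $ 2 \<or> vert s m $ 1 < 0 \<or> vert s m $ 2 < 0"
    proof -
      have x: "1 \<le> real (start_pos (Suc s))" using start_pos_ge_1[of "Suc s"] by simp
      consider "m = 2 * len + 1" | "m = 2 * len + 2" | "m = 2 * len + 3" | "m = 2 * len + 4"
        using arc_strand m by linarith
      then show ?thesis
        using x height_pos by cases (simp_all only: vert_arc point3_components, linarith+)
    qed
    ultimately show ?thesis using v by auto
  next
    case strand_arc
    have "v $ 2 = c / 2 * real m" "v $ 1 = real (pos s m)"
      using v strand_arc by (simp_all add: vert_strand)
    moreover have "0 \<le> c / 2 * real m" using c_pos by simp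
    ultimately have "1 \<le> v $ 1" "0 \<le> v $ 2" "v $ 2 < height"
      using strand_arc pos_ge_1[of s m] height_lt_iff[of m] by simp_all
    then have "m' = 2 * len + 4 \<and> v $ 1 = real (start_pos (Suc s')) \<and> v $ 2 = 0"
      using height_pos by - (rule arc_edgeE[OF v(1) strand_arc(2) m(2)], auto)
    then show ?thesis using v strand_arc c_pos by (auto simp: vert_strand pos_0)
  next
    case arcs
    obtain x' where x': "x' = real (start_pos (Suc s'))" "1 \<le> x'"
      "m' = 2 * len \<and> v $ 1 = x' \<and> height \<le> v $ 2 \<and> v $ 2 \<le> height + x' \<or>
       m' = 2 * len + 1 \<and> v $ 2 = height + x' \<and> - x' \<le> v $ 1 \<and> v $ 1 \<le> x' \<or>
       m' = 2 * len + 2 \<and> v $ 1 = - x' \<and> - x' \<le> v $ 2 \<and> v $ 2 \<le> height + x' \<or>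
       m' = 2 * len + 3 \<and> v $ 2 = - x' \<and> - x' \<le> v $ 1 \<and> v $ 1 \<le> x' \<or>
       m' = 2 * len + 4 \<and> v $ 1 = x' \<and> - x' \<le> v $ 2 \<and> v $ 2 \<le> 0"
      by (rule arc_edgeE[OF v(1) arcs(2) m(2)])
    define x where "x = real (start_pos (Suc s))"
    have x: "1 \<le> x" using start_pos_ge_1[of "Suc s"] by (simp add: x_def)
    have "x = x' \<and> (m = m' \<or> m = Suc m')"
    proof -
      consider "m = 2 * len" | "m = 2 * len + 1" | "m = 2 * len + 2" | "m = 2 * len + 3" | "m = 2 * len + 4"
        using arcs m by linarith
      then show ?thesis
      proof cases
        case 1
        then have "v $ 1 = x" "v $ 2 = height"
          using v(2,3) vert_arc(1)[of s] by (simp_all add: x_def)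
        with 1 x'(2,3) x height_pos show ?thesis
          by (intro conjI; elim disjE conjE; (linarith | simp))
      next
        case 2
        then have "v $ 1 = x" "v $ 2 = height + x"
          using v(2,3) vert_arc(2)[of s] by (simp_all add: x_def)
        with 2 x'(2,3) x height_pos show ?thesis
          by (intro conjI; elim disjE conjE; (linarith | simp))
      next
        case 3
        then have "v $ 1 = - x" "v $ 2 = height + x"
          using v(2,3) vert_arc(3)[of s] by (simp_all add: x_def)
        with 3 x'(2,3) x height_pos show ?thesis
          by (intro conjI; elim disjE conjE; (linarith | simp))
      next
        case 4
        then have "v $ 1 = - x" "v $ 2 = - x"
          using v(2,3) vert_arc(4)[of s] by (simp_all add: x_def)
        with 4 x'(2,3) x height_pos show ?thesis
          by (intro conjI; elim disjE conjE; (linarith | simp))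
      next
        case 5
        then have "v $ 1 = x" "v $ 2 = - x"
          using v(2,3) vert_arc(5)[of s] by (simp_all add: x_def)
        with 5 x'(2,3) x height_pos show ?thesis
          by (intro conjI; elim disjE conjE; (linarith | simp))
      qed
    qed
    then show ?thesis using s_eq by (auto simp: x_def x'(1))
  qed
qed

text \<open>
  Two edges that run through the same half letter and exchange their positions there.
\<close>

definition crossing_at :: "nat \<Rightarrow> nat \<Rightarrow> nat \<Rightarrow> nat \<Rightarrow> bool" where
  "crossing_at s m s' m' \<longleftrightarrow> m = m' \<and> odd m \<and> m < 2 * len \<and> s \<noteq> s' \<and>
     pos s' m = letter_perm (w ! (m div 2)) (pos s m)"

lemma crossing_at_sym: "crossing_at s m s' m' \<Longrightarrow> crossing_at s' m' s m"
  by (auto simp: crossing_at_def)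

lemma edges_meet_ordered:
  assumes s: "s < q" "s' < q" and m: "m \<le> m'" "m' < 2 * len + 5" and ne: "(s, m) \<noteq> (s', m')"
    and a: "a \<in> strand_edge s m" and b: "b \<in> strand_edge s' m'" and ab: "a $ 1 = b $ 1" "a $ 2 = b $ 2"
  shows "(\<exists>t<q. \<exists>l<2 * len + 5. a $ 1 = vert t l $ 1 \<and> a $ 2 = vert t l $ 2) \<or>
    crossing_at s m s' m' \<and> a $ 3 = lift s m / 2 \<and> b $ 3 = lift s' m' / 2"
proof -
  have vertexI: ?thesis if "t < q" "l < 2 * len + 5" "a $ 1 = vert t l $ 1" "a $ 2 = vert t l $ 2" for t l
    using that by blast
  consider (strands) "m < 2 * len" "m' < 2 * len" | (strand_arc) "m < 2 * len" "2 * len \<le> m'"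
    | (arcs) "2 * len \<le> m" "2 * len \<le> m'" using m by linarith
  then show ?thesis
  proof cases
    case strands
    from a strands(1) obtain u where u: "0 \<le> u" "u \<le> 1"
      "a $ 1 = (1 - u) * real (pos s m) + u * real (pos s (Suc m))" "a $ 2 = c / 2 * (real m + u)"
      "a $ 3 = (1 - u) * lift s m + u * lift s (Suc m)" by (rule strand_edgeE)
    from b strands(2) obtain u' where u': "0 \<le> u'" "u' \<le> 1"
      "b $ 1 = (1 - u') * real (pos s' m') + u' * real (pos s' (Suc m'))" "b $ 2 = c / 2 * (real m' + u')"
      "b $ 3 = (1 - u') * lift s' m' + u' * lift s' (Suc m')" by (rule strand_edgeE)
    have "c / 2 * (real m + u) = c / 2 * (real m' + u')" using ab(2) u(4) u'(4) by simp
    moreover have "c / 2 \<noteq> 0" using c_pos by simp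
    ultimately have mu: "real m + u = real m' + u'" using mult_left_cancel[of "c / 2"] by blast
    show ?thesis
    proof (cases "m = m'")
      case False
      then have "real m + 1 \<le> real m'" using m by linarith
      then have "u' = 0" using mu u u' by linarith
      then show ?thesis
        using ab u' strands s by (intro vertexI[of s' m']) (simp_all add: vert_strand)
    next
      case True
      then have uu: "u = u'" using mu by simp
      have "s \<noteq> s'" using ne True by simp
      then have pos_ne: "pos s m \<noteq> pos s' m" using pos_inj[OF s] by simp
      have odd: "odd m"
      proof
        assume "even m"
        then have "real (pos s m) = real (pos s' m)"
          using ab(1) u(3) u'(3) uu True by (simp add: pos_even algebra_simps)
        then show False using pos_ne by simp
      qed
      let ?a = "w ! (m div 2)"
      have "Re (strand (\<lambda>u. u) ?a u (pos s m)) = Re (strand (\<lambda>u. u) ?a u (pos s' m))"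
        using ab(1) u(3) u'(3) uu True pos_odd[OF odd strands(1)] by (simp add: strand_def algebra_simps)
      from strand_crossing[OF crossing_schedule_id _ pos_ne this] u
      have "pos s' m = letter_perm ?a (pos s m)" "u = 1/2" by auto
      moreover have "lift s (Suc m) = 0" "lift s' (Suc m) = 0" using odd by (simp_all add: lift_def)
      ultimately show ?thesis
        using odd strands True \<open>s \<noteq> s'\<close> u(5) u'(5) uu by (simp add: crossing_at_def)
    qed
  next
    case strand_arc
    from a strand_arc(1) obtain u where u: "0 \<le> u" "u \<le> 1"
      "a $ 1 = (1 - u) * real (pos s m) + u * real (pos s (Suc m))" "a $ 2 = c / 2 * (real m + u)"
      "1 \<le> a $ 1" "0 \<le> a $ 2" "a $ 2 \<le> height" by (rule strand_edgeE)
    have "a $ 2 = height \<or> a $ 2 = 0"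
      using u(5-7) unfolding ab
      by - (rule arc_edgeE[OF b strand_arc(2) m(2)]; elim disjE conjE; linarith)
    then show ?thesis
    proof
      assume "a $ 2 = height"
      then have "c / 2 * (real m + u) = c / 2 * (2 * real len)" using u(4) by (simp add: height_def)
      moreover have "c / 2 \<noteq> 0" using c_pos by simp
      ultimately have "real m + u = 2 * real len" using mult_left_cancel[of "c / 2"] by blast
      moreover have "real m + 1 \<le> 2 * real len" using strand_arc by linarith
      ultimately have "u = 1" "Suc m = 2 * len" using u by linarith+
      then show ?thesis
        using u s pos_end[of s] \<open>a $ 2 = height\<close>
        by (intro vertexI[of s "2 * len"]) (simp_all add: vert_arc(1))
    next
      assume "a $ 2 = 0"
      then have "real m + u = 0" using u(4) c_pos by simp
      then have "u = 0" "m = 0" using u by linarith+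
      then show ?thesis
        using u s strand_arc by (intro vertexI[of s m]) (simp_all add: vert_strand)
    qed
  next
    case arcs
    have m': "m < 2 * len + 5" using m by simp
    obtain x where x: "x = real (start_pos (Suc s))" "1 \<le> x"
      "m = 2 * len \<and> a $ 1 = x \<and> height \<le> a $ 2 \<and> a $ 2 \<le> height + x \<or>
       m = 2 * len + 1 \<and> a $ 2 = height + x \<and> - x \<le> a $ 1 \<and> a $ 1 \<le> x \<or>
       m = 2 * len + 2 \<and> a $ 1 = - x \<and> - x \<le> a $ 2 \<and> a $ 2 \<le> height + x \<or>
       m = 2 * len + 3 \<and> a $ 2 = - x \<and> - x \<le> a $ 1 \<and> a $ 1 \<le> x \<or>
       m = 2 * len + 4 \<and> a $ 1 = x \<and> - x \<le> a $ 2 \<and> a $ 2 \<le> 0"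
      by (rule arc_edgeE[OF a arcs(1) m'])
    obtain x' where x': "x' = real (start_pos (Suc s'))" "1 \<le> x'"
      "m' = 2 * len \<and> a $ 1 = x' \<and> height \<le> a $ 2 \<and> a $ 2 \<le> height + x' \<or>
       m' = 2 * len + 1 \<and> a $ 2 = height + x' \<and> - x' \<le> a $ 1 \<and> a $ 1 \<le> x' \<or>
       m' = 2 * len + 2 \<and> a $ 1 = - x' \<and> - x' \<le> a $ 2 \<and> a $ 2 \<le> height + x' \<or>
       m' = 2 * len + 3 \<and> a $ 2 = - x' \<and> - x' \<le> a $ 1 \<and> a $ 1 \<le> x' \<or>
       m' = 2 * len + 4 \<and> a $ 1 = x' \<and> - x' \<le> a $ 2 \<and> a $ 2 \<le> 0"
      unfolding ab by (rule arc_edgeE[OF b arcs(2) m(2)])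
    have xx: "x = x'"
      using x(2,3) x'(2,3) height_pos by (elim disjE conjE; linarith)
    then have "s = s'" using start_pos_Suc_inj[OF s] x(1) x'(1) by simp
    then have "m < m'" using m ne by auto
    then have "a $ 1 = x \<and> a $ 2 = height + x \<or> a $ 1 = - x \<and> a $ 2 = height + x \<or>
        a $ 1 = - x \<and> a $ 2 = - x \<or> a $ 1 = x \<and> a $ 2 = - x"
      using x(2,3) x'(3) height_pos unfolding xx[symmetric] by (elim disjE conjE; (linarith | simp))
    then show ?thesis
    proof (elim disjE conjE)
      assume "a $ 1 = x" "a $ 2 = height + x"
      then show ?thesis
        using s(1) vert_arc(2)[of s] x(1) by (intro vertexI[of s "2 * len + 1"]) simp_all
    next
      assume "a $ 1 = - x" "a $ 2 = height + x"
      then show ?thesis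
        using s(1) vert_arc(3)[of s] x(1) by (intro vertexI[of s "2 * len + 2"]) simp_all
    next
      assume "a $ 1 = - x" "a $ 2 = - x"
      then show ?thesis
        using s(1) vert_arc(4)[of s] x(1) by (intro vertexI[of s "2 * len + 3"]) simp_all
    next
      assume "a $ 1 = x" "a $ 2 = - x"
      then show ?thesis
        using s(1) vert_arc(5)[of s] x(1) by (intro vertexI[of s "2 * len + 4"]) simp_all
    qed
  qed
qed

lemma edges_meet:
  assumes s: "s < q" "s' < q" and m: "m < 2 * len + 5" "m' < 2 * len + 5" and ne: "(s, m) \<noteq> (s', m')"
    and a: "a \<in> strand_edge s m" and b: "b \<in> strand_edge s' m'" and ab: "a $ 1 = b $ 1" "a $ 2 = b $ 2"
  shows "(\<exists>t<q. \<exists>l<2 * len + 5. a $ 1 = vert t l $ 1 \<and> a $ 2 = vert t l $ 2) \<or>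
    crossing_at s m s' m' \<and> a $ 3 = lift s m / 2 \<and> b $ 3 = lift s' m' / 2"
proof (cases "m \<le> m'")
  case True
  then show ?thesis using edges_meet_ordered[OF s True m(2) ne a b ab] by blast
next
  case False
  then show ?thesis
    using edges_meet_ordered[OF s(2,1) _ m(1) ne[symmetric] b a ab(1)[symmetric] ab(2)[symmetric]]
      crossing_at_sym[of s' m' s m] ab by auto
qed

lemma edge_projection_injective:
  assumes "m < 2 * len + 5" "a \<in> strand_edge s m" "b \<in> strand_edge s m" "a $ 1 = b $ 1" "a $ 2 = b $ 2"
  shows "a = b"
proof (cases "m < 2 * len")
  case True
  from assms(2) True obtain u where u: "a $ 2 = c / 2 * (real m + u)"
    "a $ 3 = (1 - u) * lift s m + u * lift s (Suc m)" by (rule strand_edgeE)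
  from assms(3) True obtain u' where u': "b $ 2 = c / 2 * (real m + u')"
    "b $ 3 = (1 - u') * lift s m + u' * lift s (Suc m)" by (rule strand_edgeE)
  have "u = u'" using u(1) u'(1) assms(5) c_pos by simp
  then show ?thesis using assms u u' by (simp add: vec_eq_iff forall_3)
next
  case False
  have flat: "v $ 3 = 0" if v: "v \<in> strand_edge s m" for v
    by (rule arc_edgeE[OF v]) (use False assms(1) in simp_all)
  show ?thesis using flat[OF assms(2)] flat[OF assms(3)] assms by (simp add: vec_eq_iff forall_3)
qed

definition edges_per_strand :: nat where "edges_per_strand = 2 * len + 5"

definition vertices :: "(real^3) list" where
  "vertices = map (\<lambda>i. vert (i div edges_per_strand) (i mod edges_per_strand)) [0..<q * edges_per_strand]"

lemma edges_per_strand_pos: "0 < edges_per_strand"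
  by (simp add: edges_per_strand_def)

lemma length_vertices: "length vertices = q * edges_per_strand"
  by (simp add: vertices_def)

lemma vertices_nth:
  "i < length vertices \<Longrightarrow> vertices ! i = vert (i div edges_per_strand) (i mod edges_per_strand)"
  by (simp add: vertices_def)

lemma index_bounds:
  assumes "i < length vertices"
  shows "i div edges_per_strand < q" "i mod edges_per_strand < 2 * len + 5"
  using assms edges_per_strand_pos
  by (auto simp: length_vertices less_mult_imp_div_less edges_per_strand_def[symmetric])

lemma index_of:
  assumes "s < q" "m < 2 * len + 5"
  shows "s * edges_per_strand + m < length vertices"
    "(s * edges_per_strand + m) div edges_per_strand = s"
    "(s * edges_per_strand + m) mod edges_per_strand = m"
proof -
  have m: "m < edges_per_strand" using assms(2) by (simp add: edges_per_strand_def)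
  have "s * edges_per_strand + m < Suc s * edges_per_strand" using m by simp
  also have "\<dots> \<le> q * edges_per_strand" using assms(1) by (intro mult_le_mono1) simp
  finally show "s * edges_per_strand + m < length vertices" by (simp add: length_vertices)
  show "(s * edges_per_strand + m) div edges_per_strand = s" "(s * edges_per_strand + m) mod edges_per_strand = m"
    using m by simp_all
qed

lemma vert_wrap: "vert s edges_per_strand = vert (Suc s) 0"
  using vert_arc(6)[of s] by (simp add: edges_per_strand_def vert_strand pos_0 lift_def)

lemma vert_cycle: "vert q 0 = vert 0 0"
  using return by (simp add: vert_strand pos_0 lift_def start_pos_def)

text \<open>
  The end of a passage is the start of the next one, and the last passage ends where the first one starts.
\<close>

lemma next_vertex_vertices:
  assumes "i < length vertices"
  shows "next_vertex vertices i = vert (i div edges_per_strand) (Suc (i mod edges_per_strand))"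
proof -
  let ?M = edges_per_strand
  define s m where "s = i div ?M" and "m = i mod ?M"
  have i: "i = s * ?M + m" by (simp add: s_def m_def)
  have s: "s < q" and m: "m < 2 * len + 5" using index_bounds[OF assms] by (simp_all add: s_def m_def)
  show ?thesis
  proof (cases "Suc m < 2 * len + 5")
    case True
    note j = index_of[OF s True]
    have "Suc i = s * ?M + Suc m" by (simp add: i)
    then have "Suc i mod length vertices = s * ?M + Suc m" using j(1) by simp
    then have "next_vertex vertices i = vert s (Suc m)"
      using j vertices_nth[OF j(1)] unfolding next_vertex_def by simp
    then show ?thesis by (simp add: s_def m_def)
  next
    case False
    then have Sm: "Suc m = ?M" using m by (simp add: edges_per_strand_def)
    have Si: "Suc i = Suc s * ?M" using Sm by (simp add: i)
    have "next_vertex vertices i = vert (Suc s) 0"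
    proof (cases "Suc s < q")
      case True
      note j = index_of[OF True, of 0]
      have "Suc i mod length vertices = Suc s * ?M + 0" using j(1) Si by simp
      then show ?thesis using j vertices_nth[OF j(1)] unfolding next_vertex_def by simp
    next
      case False
      then have "Suc s = q" using s by simp
      then have "Suc i mod length vertices = 0" using Si by (simp add: length_vertices)
      then have "next_vertex vertices i = vertices ! 0" by (simp add: next_vertex_def)
      also have "0 < length vertices" using assms by linarith
      then have "vertices ! 0 = vert 0 0" using vertices_nth by simp
      also have "\<dots> = vert (Suc s) 0" unfolding \<open>Suc s = q\<close> by (rule vert_cycle[symmetric])
      finally show ?thesis .
    qed
    then show ?thesis using vert_wrap[of s] Sm by (simp add: s_def m_def)
  qed
qed

lemma edge_vertices:
  "i < length vertices \<Longrightarrow> edge vertices i = strand_edge (i div edges_per_strand) (i mod edges_per_strand)"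
  by (simp add: edge_def strand_edge_def next_vertex_vertices vertices_nth)

lemma plane_proj_eq_iff: "plane_proj a = plane_proj b \<longleftrightarrow> a $ 1 = b $ 1 \<and> a $ 2 = b $ 2"
  by (auto simp: plane_proj_def vec_eq_iff forall_2)

lemma vertex_in_edge:
  assumes "i < length vertices"
  shows "vertices ! i \<in> edge vertices i" "next_vertex vertices i \<in> edge vertices i"
  by (simp_all add: edge_def)

lemma edge_vertices_projection_injective:
  assumes "i < length vertices" "a \<in> edge vertices i" "b \<in> edge vertices i" "plane_proj a = plane_proj b"
  shows "a = b"
  using edge_projection_injective[OF index_bounds(2)[OF assms(1)]] assms
  by (simp add: edge_vertices plane_proj_eq_iff)

lemma vertex_on_edge_index:
  assumes i: "i < length vertices" and j: "j < length vertices"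
    and v: "v \<in> edge vertices j" "plane_proj v = plane_proj (vertices ! i)"
  shows "i = j \<or> i = Suc j mod length vertices"
proof -
  let ?M = edges_per_strand
  define s m s' m' where sm: "s = i div ?M" "m = i mod ?M" "s' = j div ?M" "m' = j mod ?M"
  have ij: "i = s * ?M + m" "j = s' * ?M + m'" by (simp_all add: sm)
  have b: "s < q" "s' < q" "m < 2 * len + 5" "m' < 2 * len + 5"
    using index_bounds[OF i] index_bounds[OF j] by (simp_all add: sm)
  have "v \<in> strand_edge s' m'" "v $ 1 = vert s m $ 1" "v $ 2 = vert s m $ 2"
    using v i j by (simp_all add: edge_vertices vertices_nth plane_proj_eq_iff sm)
  from vertex_on_edge[OF b this]
  consider "s = s'" "m = m'" | "s = s'" "m = Suc m'"
    | "m = 0" "Suc m' = ?M" "start_pos s = start_pos (Suc s')"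
    by (auto simp: edges_per_strand_def)
  then show ?thesis
  proof cases
    case 1
    then show ?thesis using ij by simp
  next
    case 2
    then have "i = Suc j" using ij by simp
    then show ?thesis using i by simp
  next
    case 3
    have Sj: "Suc j = Suc s' * ?M" using ij(2) 3(2) by simp
    show ?thesis
    proof (cases "Suc s' < q")
      case True
      then have "s = Suc s'" using 3(3) start_pos_inj[OF b(1) True] by simp
      then have "i = Suc j" using Sj ij(1) 3(1) by simp
      then show ?thesis using i by simp
    next
      case False
      then have q: "Suc s' = q" using b(2) by simp
      then have "start_pos s = start_pos 0" using 3(3) return by (simp add: start_pos_def)
      then have "s = 0" using start_pos_inj[OF b(1), of 0] b(1) by simp
      then show ?thesis using ij(1) 3(1) Sj q by (simp add: length_vertices)
    qed
  qed
qed

text \<open>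
  A vertex that lies on an edge in projection is an end point of this edge, so two edges that meet in
  projection over a vertex both end there.
\<close>

lemma edges_meet_cases:
  assumes i: "i < length vertices" and j: "j < length vertices" and "i \<noteq> j"
    and a: "a \<in> edge vertices i" and b: "b \<in> edge vertices j" and ab: "plane_proj a = plane_proj b"
  obtains (vertex) l where "l < length vertices" "a = vertices ! l" "b = vertices ! l"
      "l = i \<or> l = Suc i mod length vertices" "l = j \<or> l = Suc j mod length vertices"
  | (crossing) "crossing_at (i div edges_per_strand) (i mod edges_per_strand)
        (j div edges_per_strand) (j mod edges_per_strand)"
      "a $ 3 = lift (i div edges_per_strand) (i mod edges_per_strand) / 2"
      "b $ 3 = lift (j div edges_per_strand) (j mod edges_per_strand) / 2"
proof -
  let ?M = edges_per_strand
  have ne: "(i div ?M, i mod ?M) \<noteq> (j div ?M, j mod ?M)"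
    using \<open>i \<noteq> j\<close> by (metis Pair_inject div_mult_mod_eq)
  have "a \<in> strand_edge (i div ?M) (i mod ?M)" "b \<in> strand_edge (j div ?M) (j mod ?M)"
    "a $ 1 = b $ 1" "a $ 2 = b $ 2"
    using a b ab i j by (simp_all add: edge_vertices plane_proj_eq_iff)
  from edges_meet[OF index_bounds(1)[OF i] index_bounds(1)[OF j] index_bounds(2)[OF i] index_bounds(2)[OF j] ne this]
  consider t l where "t < q" "l < 2 * len + 5" "a $ 1 = vert t l $ 1" "a $ 2 = vert t l $ 2"
    | "crossing_at (i div ?M) (i mod ?M) (j div ?M) (j mod ?M)"
      "a $ 3 = lift (i div ?M) (i mod ?M) / 2" "b $ 3 = lift (j div ?M) (j mod ?M) / 2"
    by blast
  then show thesis
  proof cases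
    case (1 t l)
    \<comment> \<open>The common point has the same projection as a vertex, whose index in the list is \<open>k\<close>.\<close>
    define k where "k = t * ?M + l"
    have k: "k < length vertices" "vertices ! k = vert t l"
      using index_of[OF 1(1,2)] vertices_nth by (simp_all add: k_def)
    have ak: "plane_proj a = plane_proj (vertices ! k)" using 1 k by (simp add: plane_proj_eq_iff)
    have end_of: "(k = e \<or> k = Suc e mod length vertices) \<and> x = vertices ! k"
      if "e < length vertices" "x \<in> edge vertices e" "plane_proj x = plane_proj (vertices ! k)" for e x
    proof -
      have ke: "k = e \<or> k = Suc e mod length vertices"
        by (rule vertex_on_edge_index[OF k(1) that])
      then have "vertices ! k \<in> edge vertices e"
        using vertex_in_edge[OF that(1)] by (auto simp: next_vertex_def)
      then show ?thesis
        using ke edge_vertices_projection_injective[OF that(1,2) _ that(3)] by blast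
    qed
    show thesis
      using vertex[of k] k(1) end_of[OF i a ak] end_of[OF j b] ak ab by simp
  next
    case 2
    then show thesis by (rule crossing)
  qed
qed

lemma mod_Suc_inj:
  assumes "i < n" "j < n" "Suc i mod n = Suc j mod n" shows "i = j"
  using assms by (auto simp: mod_Suc split: if_splits)

lemma crossing_lifts:
  assumes "crossing_at s m s' m'" "s < q" "s' < q"
  shows "lift s m = 1 \<and> lift s' m' = 0 \<and> pos s m = over_pos (w ! (m div 2)) \<or>
    lift s m = 0 \<and> lift s' m' = 1 \<and> pos s' m = over_pos (w ! (m div 2))"
proof -
  let ?a = "w ! (m div 2)"
  have c: "m' = m" "odd m" "pos s' m = letter_perm ?a (pos s m)"
    and "s \<noteq> s'" using assms by (auto simp: crossing_at_def)
  have "pos s m \<noteq> pos s' m" using pos_inj[OF assms(2,3)] \<open>s \<noteq> s'\<close> by simp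
  then show ?thesis
    using over_pos_cases[OF c(3)[symmetric]] c by (auto simp: lift_def)
qed

lemma edges_on_vertex:
  assumes "i < length vertices" "l < length vertices" "v \<in> edge vertices i"
    "plane_proj v = plane_proj (vertices ! l)"
  shows "l = i \<or> l = Suc i mod length vertices"
  using vertex_on_edge_index[OF assms(2,1,3,4)] by simp

text \<open>
  Only two edges end in a vertex. At a crossing, three strands would have to exchange their positions
  pairwise within the same letter.
\<close>

lemma no_triple_points:
  assumes ijk: "i < length vertices" "j < length vertices" "k < length vertices" "i \<noteq> j" "j \<noteq> k" "i \<noteq> k"
    and p: "a \<in> edge vertices i" "b \<in> edge vertices j" "d \<in> edge vertices k"
    and eq: "plane_proj a = plane_proj b" "plane_proj b = plane_proj d"
  shows False
proof -
  have no_vertex: False if l: "l < length vertices" "plane_proj a = plane_proj (vertices ! l)" for l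
  proof -
    have "l = i \<or> l = Suc i mod length vertices" "l = j \<or> l = Suc j mod length vertices"
      "l = k \<or> l = Suc k mod length vertices"
      using edges_on_vertex[OF ijk(1) l(1) p(1)] edges_on_vertex[OF ijk(2) l(1) p(2)]
        edges_on_vertex[OF ijk(3) l(1) p(3)] l(2) eq by auto
    then show False
      using ijk(4-6) mod_Suc_inj[OF ijk(1,2)] mod_Suc_inj[OF ijk(1,3)] mod_Suc_inj[OF ijk(2,3)] by auto
  qed
  let ?s = "\<lambda>i. i div edges_per_strand" and ?m = "\<lambda>i. i mod edges_per_strand"
  have cross: "crossing_at (?s i) (?m i) (?s j) (?m j)"
    by (rule edges_meet_cases[OF ijk(1,2,4) p(1,2) eq(1)]) (use no_vertex in auto)
  moreover have "crossing_at (?s i) (?m i) (?s k) (?m k)"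
    by (rule edges_meet_cases[OF ijk(1,3,6) p(1,3)]) (use no_vertex eq in auto)
  moreover have "crossing_at (?s j) (?m j) (?s k) (?m k)"
    by (rule edges_meet_cases[OF ijk(2,3,5) p(2,3) eq(2)]) (use no_vertex eq in auto)
  ultimately have "?s j \<noteq> ?s k" "pos (?s j) (?m i) = pos (?s k) (?m i)"
    by (auto simp: crossing_at_def)
  then show False
    using pos_inj[OF index_bounds(1)[OF ijk(2)] index_bounds(1)[OF ijk(3)]] by simp
qed

lemma edges_meet_in_vertices:
  assumes "i < length vertices" "j < length vertices" "i \<noteq> j" "v \<in> edge vertices i" "v \<in> edge vertices j"
  shows "v \<in> set vertices"
proof (rule edges_meet_cases[OF assms refl])
  assume "crossing_at (i div edges_per_strand) (i mod edges_per_strand)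
        (j div edges_per_strand) (j mod edges_per_strand)"
    "v $ 3 = lift (i div edges_per_strand) (i mod edges_per_strand) / 2"
    "v $ 3 = lift (j div edges_per_strand) (j mod edges_per_strand) / 2"
  then show ?thesis
    using crossing_lifts[OF _ index_bounds(1)[OF assms(1)] index_bounds(1)[OF assms(2)]] by force
qed auto

lemma knot_diagram_vertices: "knot_diagram vertices"
proof -
  have q: "0 < q" using letters[OF hd_in_set[OF nonempty]] by simp
  have len3: "3 \<le> length vertices"
  proof -
    have "1 * 5 \<le> q * edges_per_strand" using q by (intro mult_le_mono) (auto simp: edges_per_strand_def)
    then show ?thesis by (simp add: length_vertices)
  qed
  have dist: "distinct vertices"
    unfolding distinct_conv_nth
  proof (intro allI impI notI)
    fix i j assume i: "i < length vertices" and j: "j < length vertices" and "i \<noteq> j"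
      and eq: "vertices ! i = vertices ! j"
    have *: "i = Suc j mod length vertices" "j = Suc i mod length vertices"
      using vertex_on_edge_index[OF i j vertex_in_edge(1)[OF j]] vertex_on_edge_index[OF j i vertex_in_edge(1)[OF i]]
        eq \<open>i \<noteq> j\<close> by auto
    have succ: "Suc k mod length vertices = (if Suc k = length vertices then 0 else Suc k)"
      if "k < length vertices" for k
      using that by (auto intro: mod_less)
    have "i = 0 \<and> Suc j = length vertices \<or> i = Suc j"
      using *(1) unfolding succ[OF j] by (auto split: if_splits)
    moreover have "j = 0 \<and> Suc i = length vertices \<or> j = Suc i"
      using *(2) unfolding succ[OF i] by (auto split: if_splits)
    ultimately show False using len3 by linarith
  qed
  show ?thesis
    unfolding knot_diagram_def
  proof (intro conjI allI impI)
    fix i j assume i: "i < length vertices" and j: "j < length vertices"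
    {
      assume "plane_proj (vertices ! i) \<in> plane_proj ` edge vertices j"
      then obtain v where "v \<in> edge vertices j" "plane_proj v = plane_proj (vertices ! i)" by fastforce
      then show "i = j \<or> i = Suc j mod length vertices" by (rule vertex_on_edge_index[OF i j])
    }
    show "edge vertices i \<inter> edge vertices j \<subseteq> set vertices" if "i \<noteq> j"
      using edges_meet_in_vertices[OF i j that] by blast
    fix k assume k: "k < length vertices" and ne: "i \<noteq> j \<and> j \<noteq> k \<and> i \<noteq> k"
    show "plane_proj ` edge vertices i \<inter> plane_proj ` edge vertices j \<inter> plane_proj ` edge vertices k = {}"
    proof (rule equals0I)
      fix z assume "z \<in> plane_proj ` edge vertices i \<inter> plane_proj ` edge vertices j \<inter> plane_proj ` edge vertices k"
      then obtain a b d where "a \<in> edge vertices i" "b \<in> edge vertices j" "d \<in> edge vertices k"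
        "z = plane_proj a" "z = plane_proj b" "z = plane_proj d" by blast
      then show False using no_triple_points[OF i j k, of a b d] ne by simp
    qed
  qed (use len3 dist in auto)
qed

text \<open>
  At a crossing, the over-strand runs in direction \<open>(1, c / 2)\<close> and the under-strand in direction
  \<open>(- 1, c / 2)\<close>, because the letter is positive.
\<close>

lemma positive_crossings:
  assumes "crosses_over vertices i j" shows "crossing_sign vertices i j = 1"
proof -
  from assms obtain a b where i: "i < length vertices" and j: "j < length vertices"
    and a: "a \<in> edge vertices i" and b: "b \<in> edge vertices j"
    and ab: "plane_proj a = plane_proj b" and over: "a $ 3 > b $ 3"
    unfolding crosses_over_def by blast
  have "i \<noteq> j" using edge_vertices_projection_injective[OF i a _ ab] b over by auto
  define s m s' where sm: "s = i div edges_per_strand" "m = i mod edges_per_strand" "s' = j div edges_per_strand"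
  have s: "s < q" "s' < q" using index_bounds(1) i j by (simp_all add: sm)
  have cross: "crossing_at s m s' (j mod edges_per_strand)"
    "a $ 3 = lift s m / 2" "b $ 3 = lift s' (j mod edges_per_strand) / 2"
    by (rule edges_meet_cases[OF i j \<open>i \<noteq> j\<close> a b ab]; use over in \<open>simp add: sm\<close>)+
  then have m: "j mod edges_per_strand = m" "odd m" "m < 2 * len"
    and perm: "pos s' m = letter_perm (w ! (m div 2)) (pos s m)"
    by (auto simp: crossing_at_def)
  have at_over: "pos s m = over_pos (w ! (m div 2))"
    using crossing_lifts[OF cross(1) s] over cross(2,3) by auto
  have "w ! (m div 2) \<in> set w" using m by (simp add: len_def)
  then have "0 < w ! (m div 2)" using letters by fastforce
  then have X: "real (pos s (Suc m)) - real (pos s m) = 1" "real (pos s' (Suc m)) - real (pos s' m) = - 1"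
    using at_over perm pos_odd[OF m(2,3)] by (auto simp: over_pos_def letter_perm_def)
  have u: "next_vertex vertices i - vertices ! i = vert s (Suc m) - vert s m"
    using i by (simp add: next_vertex_vertices vertices_nth sm)
  have v: "next_vertex vertices j - vertices ! j = vert s' (Suc m) - vert s' m"
    using j m(1) by (simp add: next_vertex_vertices vertices_nth sm)
  have "(vert s (Suc m) - vert s m) $ 1 = 1" "(vert s' (Suc m) - vert s' m) $ 1 = - 1"
    "(vert t (Suc m) - vert t m) $ 2 = c / 2" for t
    using X m(3) by (simp_all add: vert_strand field_simps)
  then have "crossing_sign vertices i j = sgn (1 * (c / 2) - (c / 2) * (- 1))"
    unfolding crossing_sign_def Let_def u v by (simp only:)
  then show ?thesis using c_pos by simp
qed

section \<open>The polygon is the closed braid\<close>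

lemma proper: "proper_word q w"
  using letters by (force simp: proper_word_def)

lemma strand_edges_eq_late_strand:
  assumes j: "j < len"
  shows "strand_edge s (2 * j) \<union> strand_edge s (Suc (2 * j))
    = (\<lambda>u. point3 (Re (strand late (w ! j) u (pos s (2 * j)))) (c * real j + c * u)
        (Im (strand late (w ! j) u (pos s (2 * j))))) ` {0..1}"
proof -
  let ?k = "pos s (2 * j)"
  have v: "vert s (2 * j) = point3 (real ?k) (c * real j) 0"
    "vert s (Suc (2 * j)) = point3 (real ?k) (c * real j + c / 2) (if ?k = over_pos (w ! j) then 1 else 0)"
    "vert s (Suc (Suc (2 * j))) = point3 (real (letter_perm (w ! j) ?k)) (c * real j + c) 0"
    using j pos_odd[of "Suc (2 * j)" s]
    by (simp_all add: vert_strand lift_def pos_even point3_eq_iff field_simps)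
  show ?thesis
    unfolding strand_edge_def
    by (rule image_two_segments[symmetric]; unfold v point3_combination point3_eq_iff)
       (auto simp: strand_def late_def field_simps)
qed

lemma closing_arc_eq_strand_edges:
  "closing_arc height (real (start_pos (Suc s))) = (\<Union>m\<in>{2 * len..<2 * len + 5}. strand_edge s m)"
proof -
  have "{2 * len..<2 * len + 5} = {2 * len, 2 * len + 1, 2 * len + 2, 2 * len + 3, 2 * len + 4}" by auto
  then have "(\<Union>m\<in>{2 * len..<2 * len + 5}. strand_edge s m) =
      strand_edge s (2 * len) \<union> strand_edge s (2 * len + 1) \<union> strand_edge s (2 * len + 2) \<union>
      strand_edge s (2 * len + 3) \<union> strand_edge s (2 * len + 4)" by auto
  moreover have "Suc (2 * len) = 2 * len + 1" "Suc (2 * len + 1) = 2 * len + 2" "Suc (2 * len + 2) = 2 * len + 3"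
    "Suc (2 * len + 3) = 2 * len + 4" "Suc (2 * len + 4) = 2 * len + 5" by simp_all
  ultimately show ?thesis
    unfolding closing_arc_def strand_edge_def by (simp only: vert_arc polyline.simps) auto
qed

lemma closed_polygon_vertices:
  "closed_polygon vertices = closed_braid q height (\<lambda>u. braid_motion late w (real (length w) * u))"
proof -
  have "closed_polygon vertices = (\<Union>s<q. \<Union>m<2 * len + 5. strand_edge s m)"
  proof
    show "closed_polygon vertices \<subseteq> (\<Union>s<q. \<Union>m<2 * len + 5. strand_edge s m)"
      unfolding closed_polygon_def using index_bounds edge_vertices by fastforce
    show "(\<Union>s<q. \<Union>m<2 * len + 5. strand_edge s m) \<subseteq> closed_polygon vertices"
    proof (intro UN_least)
      fix s m assume "s \<in> {..<q}" "m \<in> {..<2 * len + 5}"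
      then have i: "s < q" "m < 2 * len + 5" by auto
      show "strand_edge s m \<subseteq> closed_polygon vertices"
        unfolding closed_polygon_def using index_of[OF i] edge_vertices[OF index_of(1)[OF i]] by auto
    qed
  qed
  also have "\<dots> = (\<Union>s<q. \<Union>j<len. strand_edge s (2 * j) \<union> strand_edge s (Suc (2 * j))) \<union>
      (\<Union>s<q. closing_arc height (real (start_pos (Suc s))))"
  proof -
    have "{..<2 * len + 5} = (\<Union>j<len. {2 * j, Suc (2 * j)}) \<union> {2 * len..<2 * len + 5}"
    proof
      show "{..<2 * len + 5} \<subseteq> (\<Union>j<len. {2 * j, Suc (2 * j)}) \<union> {2 * len..<2 * len + 5}"
      proof
        fix m assume "m \<in> {..<2 * len + 5}"
        moreover have "m = 2 * (m div 2) \<or> m = Suc (2 * (m div 2))" by presburger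
        moreover have "m div 2 < len" if "m < 2 * len" using that by simp
        ultimately show "m \<in> (\<Union>j<len. {2 * j, Suc (2 * j)}) \<union> {2 * len..<2 * len + 5}"
          by (cases "m < 2 * len") auto
      qed
    qed auto
    then show ?thesis unfolding closing_arc_eq_strand_edges by auto
  qed
  also have "(\<Union>s<q. \<Union>j<len. strand_edge s (2 * j) \<union> strand_edge s (Suc (2 * j)))
      = (\<Union>j<length w. letter_part late q c (c * real j) (w ! j))"
  proof -
    have "(\<Union>s<q. strand_edge s (2 * j) \<union> strand_edge s (Suc (2 * j))) = letter_part late q c (c * real j) (w ! j)"
      if j: "j < len" for j
    proof -
      have "proper_word q (take j w)" using proper by (auto simp: proper_word_def dest: in_set_takeD)
      from end_pos_range[OF this] have "(\<lambda>s. pos s (2 * j)) ` {..<q} = {1..q}"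
        unfolding pos_def start_pos_image[symmetric] by (simp add: image_image)
      then have "letter_part late q c (c * real j) (w ! j) = (\<Union>k\<in>(\<lambda>s. pos s (2 * j)) ` {..<q}.
          (\<lambda>u. point3 (Re (strand late (w ! j) u k)) (c * real j + c * u) (Im (strand late (w ! j) u k))) ` {0..1})"
        unfolding letter_part_def by simp
      then show ?thesis using strand_edges_eq_late_strand[OF j] by simp
    qed
    then show ?thesis unfolding len_def[symmetric] by blast
  qed
  also have "(\<Union>s<q. closing_arc height (real (start_pos (Suc s)))) = (\<Union>x\<in>{1..q}. closing_arc height (real x))"
  proof -
    have "(\<lambda>s. start_pos (Suc s)) ` {..<q} = {1..q}"
      using end_pos_range[OF proper] unfolding start_pos_image[symmetric] start_pos_Suc by (simp add: image_image)
    then show ?thesis by (metis (no_types, lifting) SUP_cong image_image)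
  qed
  also have "(\<Union>j<length w. letter_part late q c (c * real j) (w ! j)) \<union> (\<Union>x\<in>{1..q}. closing_arc height (real x))
      = closed_braid q height (\<lambda>u. braid_motion late w (real (length w) * u))"
    by (rule closed_motion_eq_letter_parts[OF crossing_schedule_late proper nonempty, symmetric])
       (simp add: height_def len_def)
  finally show ?thesis .
qed

end

section \<open>Positivity of twisted torus knots\<close>

text \<open>
  The closure of \<open>v\<close> is isotopic to the closed motion of \<open>w\<close> with the late schedule, drawn on the same
  heights, and this is the polygon of the locale for letters of height \<open>length v / length w\<close>.
\<close>

lemma positive_closed_braid_is_positive_knot:
  assumes "v \<doteq> w" "proper_word q v" "v \<noteq> []" "positive_word q w" "w \<noteq> []"
    and "bij_betw (\<lambda>s. (end_pos v ^^ s) 1) {..<q} {1..q}" "(end_pos v ^^ q) 1 = 1"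
  shows "positive_knot (braid_closure q v)"
proof -
  define c where "c = real (length v) / real (length w)"
  have v: "0 \<notin> set v" using assms(2) by (auto simp: proper_word_def)
  have end_pos: "end_pos v = end_pos w" by (rule braid_eq_same_end_pos[OF assms(1) v])
  interpret positive_braid_knot q w c
    using assms unfolding end_pos by unfold_locales (simp_all add: c_def)
  have height: "height = real (length v)" 
    unfolding height_def len_def using assms(5) by (simp add: c_def)
  have "ambient_isotopic (braid_closure q v) (closed_polygon vertices)"
    unfolding braid_closure_eq_closed_motion[OF assms(2,3)] closed_polygon_vertices height
    using assms(3) by (intro homotopic_motions_ambient_isotopic braid_eq_motions_homotopic
        assms(1) v crossing_schedule_late) simp
  then show ?thesis
    unfolding positive_knot_def diagram_of_def
    using knot_diagram_vertices positive_crossings by blast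
qed

lemma end_pos_descending_word:
  assumes "1 \<le> m"
  shows "end_pos (descending_word m) k = (if 1 \<le> k \<and> k < m then Suc k else if k = m then 1 else k)"
  using assms
proof (induction m arbitrary: k rule: dec_induct)
  case base
  then show ?case by (auto simp: descending_word_def)
next
  case (step m)
  then show ?case by (auto simp: descending_word_Suc letter_perm_def)
qed

lemma end_pos_descending_power:
  assumes "1 \<le> k" "k \<le> m"
  shows "end_pos (word_power (descending_word m) e) k = Suc ((k - 1 + e) mod m)"
proof (induction e)
  case 0
  then show ?case using assms by simp
next
  case (Suc e)
  have m: "1 \<le> m" using assms by simp
  have "end_pos (word_power (descending_word m) (Suc e)) k
      = end_pos (descending_word m) (Suc ((k - 1 + e) mod m))"
    by (simp only: word_power_Suc_right end_pos_append Suc.IH)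
  also have "(k - 1 + e) mod m < m" using m by simp
  then have "end_pos (descending_word m) (Suc ((k - 1 + e) mod m)) = Suc (Suc (k - 1 + e) mod m)"
    by (auto simp: end_pos_descending_word[OF m] mod_Suc)
  finally show ?case by simp
qed

lemma end_pos_outside:
  assumes "proper_word m w" "m < k" shows "end_pos w k = k"
  using assms by (induction w arbitrary: k) (auto simp: proper_word_def letter_perm_def)

lemma proper_word_append [simp]: "proper_word q (v @ w) \<longleftrightarrow> proper_word q v \<and> proper_word q w"
  by (auto simp: proper_word_def)

lemma proper_word_power: "proper_word q w \<Longrightarrow> proper_word q (word_power w n)"
  by (auto simp: proper_word_def)

lemma proper_word_inverse: "proper_word q w \<Longrightarrow> proper_word q (braid_inverse w)"
  by (auto simp: proper_word_def braid_inverse_def)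

lemma proper_word_braid_power: "proper_word q w \<Longrightarrow> proper_word q (braid_power w n)"
  by (simp add: braid_power_def proper_word_power proper_word_inverse)

lemma proper_descending_word: "m \<le> q \<Longrightarrow> proper_word q (descending_word m)"
  by (auto simp: proper_word_def set_descending_word)

text \<open>
  A full twist returns every strand to its position, hence so does its inverse.
\<close>

lemma end_pos_inverse_full_twists:
  assumes "1 \<le> r" "1 \<le> k"
  shows "end_pos (word_power (braid_inverse (descending_word r)) (r * n)) k = k"
proof -
  let ?D = "word_power (descending_word r) (r * n)"
  have zero: "0 \<notin> set (descending_word r)" by (auto simp: set_descending_word)
  have "end_pos (?D @ word_power (braid_inverse (descending_word r)) (r * n)) = end_pos []"
    using proper_word_power[OF proper_descending_word[OF order_refl], of r "r * n"]
      proper_word_power[OF proper_word_inverse[OF proper_descending_word[OF order_refl]], of r "r * n"]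
    by (intro braid_eq_same_end_pos cancel_inverse_power zero) (auto simp: proper_word_def)
  then have "end_pos (word_power (braid_inverse (descending_word r)) (r * n)) (end_pos ?D k) = k"
    by (metis end_pos.simps(1) end_pos_append)
  moreover have "end_pos ?D k = k"
  proof (cases "k \<le> r")
    case True
    have "(k - 1 + r * n) mod r = k - 1"
      unfolding mod_mult_self2 using True assms by simp
    then show ?thesis using end_pos_descending_power[OF assms(2) True, of "r * n"] assms by simp
  next
    case False
    then show ?thesis
      by (intro end_pos_outside[of r] proper_word_power proper_descending_word) auto
  qed
  ultimately show ?thesis by simp
qed

lemma end_pos_twisted_torus_word:
  assumes "1 \<le> r" "1 \<le> k" "k \<le> q"
  shows "end_pos (braid_power (descending_word q) (int p) @ braid_power (descending_word r) (int r * - int n)) k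
    = Suc ((k - 1 + p) mod q)"
proof -
  have "braid_power (descending_word q) (int p) = word_power (descending_word q) p"
    by (simp add: braid_power_def)
  then show ?thesis
    unfolding braid_power_negative
    using assms by (simp add: end_pos_append end_pos_descending_power end_pos_inverse_full_twists)
qed

text \<open>
  A rotation by \<open>p\<close> of \<open>q\<close> places has a single cycle because the multiples of \<open>p\<close> run through all
  residues modulo \<open>q\<close>.
\<close>

lemma rotation_single_cycle:
  fixes f :: "nat \<Rightarrow> nat"
  assumes "coprime p q" "1 \<le> q" and f: "\<And>k. 1 \<le> k \<Longrightarrow> k \<le> q \<Longrightarrow> f k = Suc ((k - 1 + p) mod q)"
  shows "bij_betw (\<lambda>s. (f ^^ s) 1) {..<q} {1..q}" "(f ^^ q) 1 = 1"
proof -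
  have iterate: "(f ^^ s) 1 = Suc (s * p mod q)" for s
  proof (induction s)
    case (Suc s)
    have "(f ^^ Suc s) 1 = f (Suc (s * p mod q))" using Suc by simp
    also have "\<dots> = Suc ((s * p mod q + p) mod q)"
    proof -
      have "s * p mod q < q" using assms(2) by simp
      then show ?thesis by (subst f) auto
    qed
    also have "\<dots> = Suc (Suc s * p mod q)" by (simp only: mult_Suc add.commute[of p] mod_add_left_eq)
    finally show ?case .
  qed simp
  then show "(f ^^ q) 1 = 1" by simp
  have inj: "inj_on (\<lambda>s. Suc (s * p mod q)) {..<q}"
  proof (rule linorder_inj_onI)
    fix s t assume st: "s < t" "s \<in> {..<q}" "t \<in> {..<q}"
    show "Suc (s * p mod q) \<noteq> Suc (t * p mod q)"
    proof
      assume "Suc (s * p mod q) = Suc (t * p mod q)"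
      then have "q dvd t * p - s * p"
        using st mod_eq_dvd_iff_nat[of "s * p" "t * p" q] by simp
      then have "q dvd (t - s) * p" by (simp add: diff_mult_distrib)
      then have "q dvd t - s"
        using assms(1) coprime_dvd_mult_left_iff[of q p "t - s"] by (simp add: coprime_commute)
      then show False using st by (auto dest!: dvd_imp_le)
    qed
  qed auto
  have "(\<lambda>s. Suc (s * p mod q)) ` {..<q} \<subseteq> {1..q}"
  proof (intro image_subsetI)
    fix s
    have "s * p mod q < q" using assms(2) by simp
    then show "Suc (s * p mod q) \<in> {1..q}" by simp
  qed
  moreover have "card ((\<lambda>s. Suc (s * p mod q)) ` {..<q}) = card {1..q}"
    using card_image[OF inj] by simp
  ultimately have "(\<lambda>s. Suc (s * p mod q)) ` {..<q} = {1..q}" by (intro card_subset_eq) auto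
  with inj show "bij_betw (\<lambda>s. (f ^^ s) 1) {..<q} {1..q}" 
    unfolding bij_betw_def iterate by blast
qed

theorem theorem2:
  fixes p q r n k e :: nat
  assumes "p \<ge> 2" and "q \<ge> 2" and "r \<ge> 2"
    and "coprime p q"
    and "r \<le> q"
    and "1 \<le> e" and "e < q" and "p = k * q + e"
    and "n < k + 1 \<or> (n = k + 1 \<and> r \<le> e)"
  shows "positive_knot (twisted_torus_knot p q r (- int n))"
proof -
  let ?v = "braid_power (descending_word q) (int p) @ braid_power (descending_word r) (int r * - int n)"
  obtain w where w: "positive_word q w" "?v \<doteq> w"
    using twisted_torus_word_positive[OF assms(5,8,7,9)] by blast
  have rotation: "end_pos ?v k = Suc ((k - 1 + p) mod q)" if "1 \<le> k" "k \<le> q" for k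
    using assms(3) that by (intro end_pos_twisted_torus_word) auto
  have proper: "proper_word q ?v"
    unfolding proper_word_append
    using assms(5) by (intro conjI proper_word_braid_power proper_descending_word) auto
  have moves: "end_pos ?v 1 \<noteq> 1"
    using rotation[of 1] assms(2,6,7,8) by simp
  then have "?v \<noteq> []" by auto
  moreover have "w \<noteq> []"
  proof
    assume "w = []"
    moreover have "end_pos ?v = end_pos w"
      using proper by (intro braid_eq_same_end_pos w(2)) (auto simp: proper_word_def)
    ultimately show False using moves by simp
  qed
  moreover have "1 \<le> q" using assms(2) by simp
  ultimately have "positive_knot (braid_closure q ?v)"
    using w proper rotation_single_cycle[OF assms(4) _ rotation]
    by (intro positive_closed_braid_is_positive_knot[where w=w]) auto
  then show ?thesis by (simp add: twisted_torus_knot_def)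
qed

end
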